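(* Let $R$ be a ring and let $M$ be a left $R$-module that is a self-progenerator in $\sigma[M]$. Then $$\Psi(M)=\{N\in\Lambda^{fi}(M)\mid N+\mathrm{Ann}_M(Rn)=M\text{ for all }n\in N\},$$ ordered by inclusion, is a spatial frame.
   Context: Rings are associative with identity, not necessarily commutative; modules are unital left modules. $\sigma[M]$ is the full subcategory of $R$-modules consisting of all modules that embed in an $M$-generated module (a quotient of a direct sum of copies of $M$). $M$ is projective in $\sigma[M]$ if for every epimorphism $X\to Y$ in $\sigma[M]$ the induced map $\mathrm{Hom}_R(M,X)\to\mathrm{Hom}_R(M,Y)$ is surjective. $M$ is a self-progenerator in $\sigma[M]$ if $M$ is projective in $\sigma[M]$ and $M$ generates all its submodules (every submodule of $M$ is $M$-generated). $\Lambda^{fi}(M)$ is the lattice of fully invariant submodules of $M$, i.e. submodules $N$ with $f(N)\subseteq N$ for all $f\in\mathrm{End}_R(M)$. For a module $K$, $\mathrm{Ann}_M(K)=\bigcap\{\ker f\mid f\in\mathrm{Hom}_R(M,K)\}$. A frame is a complete lattice in which $a\wedge\bigvee X=\bigvee\{a\wedge x\mid x\in X\}$ for every element $a$ and subset $X$. A point of a frame $A$ is $p\neq 1$ with $a\wedge b\leq p\Rightarrow a\leq p$ or $b\leq p$; $\mathrm{pt}(A)$ is the set of points, with open sets $U_A(a)=\{p\in\mathrm{pt}(A)\mid a\nleq p\}$; $A$ is spatial if $U_A\colon A\to\mathcal{O}(\mathrm{pt}(A))$ is injective. *)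

theory Defs
  imports "HOL-Algebra.Module" "HOL-Algebra.AbelCoset" "HOL-Algebra.Complete_Lattice"
begin

section \<open>Left modules over an arbitrary ring\<close>

text \<open>The library locale \<open>module\<close> assumes a commutative ring; this is the same
  locale with \<open>cring\<close> weakened to \<open>ring\<close>. The library predicate
  \<open>submodule\<close> does not refer to commutativity and is used as it stands.\<close>

locale left_module = R?: ring R + M?: abelian_group M
  for R :: "('r, 'a) ring_scheme" (structure)
    and M :: "('r, 'm, 'b) module_scheme" (structure) +
  assumes smult_closed [simp, intro]:
      "\<lbrakk>a \<in> carrier R; x \<in> carrier M\<rbrakk> \<Longrightarrow> a \<odot>\<^bsub>M\<^esub> x \<in> carrier M"
    and smult_l_distr:
      "\<lbrakk>a \<in> carrier R; b \<in> carrier R; x \<in> carrier M\<rbrakk> \<Longrightarrow>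
       (a \<oplus>\<^bsub>R\<^esub> b) \<odot>\<^bsub>M\<^esub> x = a \<odot>\<^bsub>M\<^esub> x \<oplus>\<^bsub>M\<^esub> b \<odot>\<^bsub>M\<^esub> x"
    and smult_r_distr:
      "\<lbrakk>a \<in> carrier R; x \<in> carrier M; y \<in> carrier M\<rbrakk> \<Longrightarrow>
       a \<odot>\<^bsub>M\<^esub> (x \<oplus>\<^bsub>M\<^esub> y) = a \<odot>\<^bsub>M\<^esub> x \<oplus>\<^bsub>M\<^esub> a \<odot>\<^bsub>M\<^esub> y"
    and smult_assoc1:
      "\<lbrakk>a \<in> carrier R; b \<in> carrier R; x \<in> carrier M\<rbrakk> \<Longrightarrow>
       (a \<otimes>\<^bsub>R\<^esub> b) \<odot>\<^bsub>M\<^esub> x = a \<odot>\<^bsub>M\<^esub> (b \<odot>\<^bsub>M\<^esub> x)"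
    and smult_one [simp]:
      "x \<in> carrier M \<Longrightarrow> \<one>\<^bsub>R\<^esub> \<odot>\<^bsub>M\<^esub> x = x"

definition mod_hom ::
    "('r, 'a) ring_scheme \<Rightarrow> ('r, 'x, 'b) module_scheme \<Rightarrow> ('r, 'y, 'c) module_scheme \<Rightarrow> ('x \<Rightarrow> 'y) set"
  where "mod_hom R X Y =
    {f \<in> carrier X \<rightarrow> carrier Y.
       (\<forall>x\<in>carrier X. \<forall>y\<in>carrier X. f (x \<oplus>\<^bsub>X\<^esub> y) = f x \<oplus>\<^bsub>Y\<^esub> f y) \<and>
       (\<forall>r\<in>carrier R. \<forall>x\<in>carrier X. f (r \<odot>\<^bsub>X\<^esub> x) = r \<odot>\<^bsub>Y\<^esub> f x)}"

text \<open>The direct sum of copies of \<open>M\<close> indexed by \<open>I\<close>: finitely supported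
  families, set to zero outside \<open>I\<close>. The fields \<open>mult\<close> and \<open>one\<close>
  of the module record carry no information.\<close>

definition direct_sum :: "'i set \<Rightarrow> ('r, 'm, 'b) module_scheme \<Rightarrow> ('r, 'i \<Rightarrow> 'm) module"
  where "direct_sum I M =
    \<lparr>carrier = {v. (\<forall>i\<in>I. v i \<in> carrier M) \<and> (\<forall>i. i \<notin> I \<longrightarrow> v i = \<zero>\<^bsub>M\<^esub>)
                   \<and> finite {i \<in> I. v i \<noteq> \<zero>\<^bsub>M\<^esub>}},
     mult = undefined, one = undefined,
     zero = (\<lambda>i. \<zero>\<^bsub>M\<^esub>),
     add = (\<lambda>v w i. if i \<in> I then v i \<oplus>\<^bsub>M\<^esub> w i else \<zero>\<^bsub>M\<^esub>),
     smult = (\<lambda>r v i. if i \<in> I then r \<odot>\<^bsub>M\<^esub> v i else \<zero>\<^bsub>M\<^esub>)\<rparr>"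


section \<open>The category \<open>\<sigma>[M]\<close> and self-progenerators\<close>

text \<open>The following three notions quantify over index sets and over modules. HOL
  cannot quantify over types, so a type argument \<open>'u\<close> says where these index sets
  and modules live. Below, \<open>'u\<close> is instantiated with
  \<open>('r \<times> 'm) list\<close>, which is infinite and at least as large as \<open>R\<close> and
  \<open>M\<close>; the lemmas \<open>M_generated_universe\<close> and
  \<open>projective_in_sigma_universe\<close> at the end of this theory show that a different
  choice of \<open>'u\<close> imposes no further condition.\<close>

definition M_generated ::
    "'u itself \<Rightarrow> ('r, 'a) ring_scheme \<Rightarrow> ('r, 'm, 'b) module_scheme \<Rightarrow> ('r, 'x, 'c) module_scheme \<Rightarrow> bool"
  where "M_generated U R M X \<longleftrightarrow>
    (\<exists>(I :: 'u set) p. p \<in> mod_hom R (direct_sum I M) X \<and> p ` carrier (direct_sum I M) = carrier X)"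

definition in_sigma ::
    "'u itself \<Rightarrow> ('r, 'a) ring_scheme \<Rightarrow> ('r, 'm, 'b) module_scheme \<Rightarrow> ('r, 'x, 'c) module_scheme \<Rightarrow> bool"
  where "in_sigma U R M X \<longleftrightarrow> left_module R X \<and>
    (\<exists>(Q :: ('r, 'u) module) e.
       left_module R Q \<and> M_generated U R M Q \<and> e \<in> mod_hom R X Q \<and> inj_on e (carrier X))"

text \<open>Epimorphisms in \<open>\<sigma>[M]\<close> are the surjective homomorphisms.\<close>

definition projective_in_sigma ::
    "'u itself \<Rightarrow> ('r, 'a) ring_scheme \<Rightarrow> ('r, 'm, 'b) module_scheme \<Rightarrow> bool"
  where "projective_in_sigma U R M \<longleftrightarrow>
    (\<forall>(X :: ('r, 'u) module) (Y :: ('r, 'u) module) p.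
       in_sigma U R M X \<longrightarrow> in_sigma U R M Y \<longrightarrow>
       p \<in> mod_hom R X Y \<longrightarrow> p ` carrier X = carrier Y \<longrightarrow>
       (\<forall>f\<in>mod_hom R M Y. \<exists>g\<in>mod_hom R M X. \<forall>m\<in>carrier M. p (g m) = f m))"

definition self_progenerator :: "('r, 'a) ring_scheme \<Rightarrow> ('r, 'm, 'b) module_scheme \<Rightarrow> bool"
  where "self_progenerator R M \<longleftrightarrow>
    projective_in_sigma TYPE(('r \<times> 'm) list) R M \<and>
    (\<forall>N. submodule N R M \<longrightarrow> M_generated TYPE(('r \<times> 'm) list) R M (M\<lparr>carrier := N\<rparr>))"


section \<open>Fully invariant submodules, annihilators and \<open>\<Psi>(M)\<close>\<close>

definition fully_invariant :: "('r, 'a) ring_scheme \<Rightarrow> ('r, 'm, 'b) module_scheme \<Rightarrow> 'm set \<Rightarrow> bool"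
  where "fully_invariant R M N \<longleftrightarrow> submodule N R M \<and> (\<forall>f\<in>mod_hom R M M. f ` N \<subseteq> N)"

definition Ann_in ::
    "('r, 'a) ring_scheme \<Rightarrow> ('r, 'm, 'b) module_scheme \<Rightarrow> ('r, 'k, 'c) module_scheme \<Rightarrow> 'm set"
  where "Ann_in R M K = (\<Inter>f\<in>mod_hom R M K. {m \<in> carrier M. f m = \<zero>\<^bsub>K\<^esub>})"

definition cyclic_submodule ::
    "('r, 'a) ring_scheme \<Rightarrow> ('r, 'm, 'b) module_scheme \<Rightarrow> 'm \<Rightarrow> 'm set"
  where "cyclic_submodule R M n = {r \<odot>\<^bsub>M\<^esub> n | r. r \<in> carrier R}"

definition Psi :: "('r, 'a) ring_scheme \<Rightarrow> ('r, 'm, 'b) module_scheme \<Rightarrow> 'm set set"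
  where "Psi R M =
    {N. fully_invariant R M N \<and>
        (\<forall>n\<in>N. N <+>\<^bsub>M\<^esub> Ann_in R M (M\<lparr>carrier := cyclic_submodule R M n\<rparr>) = carrier M)}"

definition inclusion_order :: "'m set set \<Rightarrow> 'm set gorder"
  where "inclusion_order S = \<lparr>carrier = S, eq = (=), le = (\<subseteq>)\<rparr>"


section \<open>Frames and spatiality\<close>

locale frame = complete_lattice A for A (structure) +
  assumes inf_sup_distrib:
    "\<lbrakk>a \<in> carrier A; X \<subseteq> carrier A\<rbrakk> \<Longrightarrow> a \<sqinter> (\<Squnion> X) = \<Squnion> ((\<lambda>x. a \<sqinter> x) ` X)"

definition pt :: "('p, 'c) gorder_scheme \<Rightarrow> 'p set"
  where "pt A = {p \<in> carrier A. p \<noteq> \<top>\<^bsub>A\<^esub> \<and>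
    (\<forall>a\<in>carrier A. \<forall>b\<in>carrier A. a \<sqinter>\<^bsub>A\<^esub> b \<sqsubseteq>\<^bsub>A\<^esub> p \<longrightarrow> a \<sqsubseteq>\<^bsub>A\<^esub> p \<or> b \<sqsubseteq>\<^bsub>A\<^esub> p)}"

definition pt_open :: "('p, 'c) gorder_scheme \<Rightarrow> 'p \<Rightarrow> 'p set"
  where "pt_open A a = {p \<in> pt A. \<not> a \<sqsubseteq>\<^bsub>A\<^esub> p}"

definition spatial :: "('p, 'c) gorder_scheme \<Rightarrow> bool"
  where "spatial A \<longleftrightarrow> inj_on (pt_open A) (carrier A)"


section \<open>Independence of the universe\<close>

lemma mod_homI:
  assumes "\<And>x. x \<in> carrier X \<Longrightarrow> f x \<in> carrier Y"
    and "\<And>x y. \<lbrakk>x \<in> carrier X; y \<in> carrier X\<rbrakk> \<Longrightarrow> f (x \<oplus>\<^bsub>X\<^esub> y) = f x \<oplus>\<^bsub>Y\<^esub> f y"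
    and "\<And>r x. \<lbrakk>r \<in> carrier R; x \<in> carrier X\<rbrakk> \<Longrightarrow> f (r \<odot>\<^bsub>X\<^esub> x) = r \<odot>\<^bsub>Y\<^esub> f x"
  shows "f \<in> mod_hom R X Y"
  using assms by (auto simp: mod_hom_def)

lemma mod_homD:
  assumes "f \<in> mod_hom R X Y"
  shows "x \<in> carrier X \<Longrightarrow> f x \<in> carrier Y"
    and "\<lbrakk>x \<in> carrier X; y \<in> carrier X\<rbrakk> \<Longrightarrow> f (x \<oplus>\<^bsub>X\<^esub> y) = f x \<oplus>\<^bsub>Y\<^esub> f y"
    and "\<lbrakk>r \<in> carrier R; x \<in> carrier X\<rbrakk> \<Longrightarrow> f (r \<odot>\<^bsub>X\<^esub> x) = r \<odot>\<^bsub>Y\<^esub> f x"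
  using assms by (auto simp: mod_hom_def)

lemma mod_hom_comp:
  assumes "f \<in> mod_hom R X Y" "g \<in> mod_hom R Y Z"
  shows "(\<lambda>x. g (f x)) \<in> mod_hom R X Z"
  using assms by (auto simp: mod_hom_def Pi_def)

context left_module
begin

lemma smult_l_null [simp]: "x \<in> carrier M \<Longrightarrow> \<zero>\<^bsub>R\<^esub> \<odot>\<^bsub>M\<^esub> x = \<zero>\<^bsub>M\<^esub>"
  using smult_l_distr[of "\<zero>\<^bsub>R\<^esub>" "\<zero>\<^bsub>R\<^esub>" x]
  by (metis M.add.r_cancel_one' R.l_zero R.zero_closed smult_closed)

lemma smult_r_null [simp]: "a \<in> carrier R \<Longrightarrow> a \<odot>\<^bsub>M\<^esub> \<zero>\<^bsub>M\<^esub> = \<zero>\<^bsub>M\<^esub>"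
  using smult_r_distr[of a "\<zero>\<^bsub>M\<^esub>" "\<zero>\<^bsub>M\<^esub>"]
  by (metis M.add.r_cancel_one' M.l_zero M.zero_closed smult_closed)

lemma smult_minus_one: "x \<in> carrier M \<Longrightarrow> (\<ominus>\<^bsub>R\<^esub> \<one>\<^bsub>R\<^esub>) \<odot>\<^bsub>M\<^esub> x = \<ominus>\<^bsub>M\<^esub> x"
  using smult_l_distr[of "\<ominus>\<^bsub>R\<^esub> \<one>\<^bsub>R\<^esub>" "\<one>\<^bsub>R\<^esub>" x]
  by (metis M.minus_equality R.add.inv_closed R.l_neg R.one_closed smult_closed smult_l_null smult_one)

lemma left_submoduleI:
  assumes "N \<subseteq> carrier M" "\<zero>\<^bsub>M\<^esub> \<in> N"
    and "\<And>x y. \<lbrakk>x \<in> N; y \<in> N\<rbrakk> \<Longrightarrow> x \<oplus>\<^bsub>M\<^esub> y \<in> N"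
    and "\<And>a x. \<lbrakk>a \<in> carrier R; x \<in> N\<rbrakk> \<Longrightarrow> a \<odot>\<^bsub>M\<^esub> x \<in> N"
  shows "submodule N R M"
proof -
  have "\<ominus>\<^bsub>M\<^esub> x \<in> N" if "x \<in> N" for x
    using assms(4)[of "\<ominus>\<^bsub>R\<^esub> \<one>\<^bsub>R\<^esub>" x] assms(1) that smult_minus_one[of x] by auto
  then show ?thesis
    using assms by (intro submodule.intro subgroup.intro submodule_axioms.intro) (auto simp: a_inv_def)
qed

lemma submodule_left_module:
  assumes "submodule N R M"
  shows "left_module R (M\<lparr>carrier := N\<rparr>)"
proof -
  interpret N: submodule N R M by fact
  have sub: "N \<subseteq> carrier M" using N.subset by simp
  have "abelian_monoid (M\<lparr>carrier := N\<rparr>)"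
    using comm_monoid.submonoid_is_comm_monoid[OF M.a_comm_monoid]
      N.subgroup_is_submonoid
    unfolding abelian_monoid_def by simp
  moreover have "abelian_group_axioms (M\<lparr>carrier := N\<rparr>)"
    using N.subgroup_is_group[OF M.a_group] M.a_comm_group \<open>abelian_monoid _\<close>
    unfolding abelian_group_axioms_def comm_group_def abelian_monoid_def by simp
  ultimately have "abelian_group (M\<lparr>carrier := N\<rparr>)"
    by (rule abelian_group.intro)
  then show ?thesis
    using sub R.ring_axioms
    by (intro left_module.intro left_module_axioms.intro)
       (auto simp: smult_l_distr smult_r_distr smult_assoc1 subset_iff)
qed

end

lemma mod_hom_zero:
  assumes "f \<in> mod_hom R X Y" "left_module R X" "left_module R Y"
  shows "f \<zero>\<^bsub>X\<^esub> = \<zero>\<^bsub>Y\<^esub>"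
proof -
  interpret X: left_module R X by fact
  interpret Y: left_module R Y by fact
  show ?thesis
    using mod_homD(1,3)[OF assms(1)] X.smult_l_null Y.smult_l_null
    by (metis X.M.zero_closed X.R.zero_closed)
qed

lemma image_submodule:
  assumes f: "f \<in> mod_hom R X Y" and X: "left_module R X" and Y: "left_module R Y"
  shows "submodule (f ` carrier X) R Y"
proof -
  interpret X: left_module R X by fact
  interpret Y: left_module R Y by fact
  show ?thesis
  proof (rule Y.left_submoduleI)
    show "f ` carrier X \<subseteq> carrier Y" using mod_homD(1)[OF f] by auto
    show "\<zero>\<^bsub>Y\<^esub> \<in> f ` carrier X"
      using mod_hom_zero[OF f X Y] X.M.zero_closed by (metis imageI)
    show "x \<oplus>\<^bsub>Y\<^esub> y \<in> f ` carrier X" if "x \<in> f ` carrier X" "y \<in> f ` carrier X" for x y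
      using that mod_homD(2)[OF f] X.M.a_closed by (smt (verit) imageE imageI)
    show "a \<odot>\<^bsub>Y\<^esub> x \<in> f ` carrier X" if "a \<in> carrier R" "x \<in> f ` carrier X" for a x
      using that mod_homD(3)[OF f] X.smult_closed by (smt (verit) imageE imageI)
  qed
qed

text \<open>Transport of structure along an injection.\<close>

definition transport :: "('x \<Rightarrow> 'u) \<Rightarrow> ('r, 'x, 'c) module_scheme \<Rightarrow> ('r, 'u) module"
  where "transport j X =
    \<lparr>carrier = j ` carrier X, mult = undefined, one = undefined, zero = j \<zero>\<^bsub>X\<^esub>,
     add = (\<lambda>x y. j (inv_into (carrier X) j x \<oplus>\<^bsub>X\<^esub> inv_into (carrier X) j y)),
     smult = (\<lambda>r x. j (r \<odot>\<^bsub>X\<^esub> inv_into (carrier X) j x))\<rparr>"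

lemma transport_left_module:
  assumes X: "left_module R X" and j: "inj_on j (carrier X)"
  shows "left_module R (transport j X)"
proof -
  interpret X: left_module R X by fact
  have "abelian_group (transport j X)"
  proof (rule abelian_groupI)
    fix x assume "x \<in> carrier (transport j X)"
    then obtain a where a: "a \<in> carrier X" "x = j a" by (auto simp: transport_def)
    show "\<exists>y\<in>carrier (transport j X). y \<oplus>\<^bsub>transport j X\<^esub> x = \<zero>\<^bsub>transport j X\<^esub>"
      using a j by (intro bexI[of _ "j (\<ominus>\<^bsub>X\<^esub> a)"]) (auto simp: transport_def X.M.l_neg)
  qed (use j in \<open>auto simp: transport_def X.M.a_ac\<close>)
  then show ?thesis
    using X.R.ring_axioms j
    by (intro left_module.intro left_module_axioms.intro)
       (auto simp: transport_def X.smult_l_distr X.smult_r_distr X.smult_assoc1)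
qed

lemma transport_hom:
  assumes "left_module R X" "inj_on j (carrier X)"
  shows "j \<in> mod_hom R X (transport j X)"
  using assms by (intro mod_homI) (auto simp: transport_def)

lemma transport_inv_hom:
  assumes X: "left_module R X" and j: "inj_on j (carrier X)"
  shows "inv_into (carrier X) j \<in> mod_hom R (transport j X) X"
proof -
  interpret X: left_module R X by fact
  show ?thesis using j by (intro mod_homI) (auto simp: transport_def)
qed

lemma direct_sum_left_module:
  assumes M: "left_module R M"
  shows "left_module R (direct_sum I M)"
proof -
  interpret M: left_module R M by fact
  have fin_add: "finite {i \<in> I. v i \<oplus>\<^bsub>M\<^esub> w i \<noteq> \<zero>\<^bsub>M\<^esub>}"
    if "finite {i \<in> I. v i \<noteq> \<zero>\<^bsub>M\<^esub>}" "finite {i \<in> I. w i \<noteq> \<zero>\<^bsub>M\<^esub>}" for v w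
    by (rule finite_subset[OF _ finite_UnI[OF that]]) auto
  have fin_smult: "finite {i \<in> I. r \<odot>\<^bsub>M\<^esub> v i \<noteq> \<zero>\<^bsub>M\<^esub>}"
    if "finite {i \<in> I. v i \<noteq> \<zero>\<^bsub>M\<^esub>}" "r \<in> carrier R" for v r
    by (rule finite_subset[OF _ that(1)]) (use that(2) in auto)
  have cl: "v i \<in> carrier M" if "v \<in> carrier (direct_sum I M)" for v i
    using that by (cases "i \<in> I") (auto simp: direct_sum_def)
  have "abelian_group (direct_sum I M)"
  proof (rule abelian_groupI)
    fix v assume v: "v \<in> carrier (direct_sum I M)"
    show "\<exists>w\<in>carrier (direct_sum I M). w \<oplus>\<^bsub>direct_sum I M\<^esub> v = \<zero>\<^bsub>direct_sum I M\<^esub>"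
      using v fin_smult[of v "\<ominus>\<^bsub>R\<^esub> \<one>\<^bsub>R\<^esub>"]
      by (intro bexI[of _ "\<lambda>i. if i \<in> I then (\<ominus>\<^bsub>R\<^esub> \<one>\<^bsub>R\<^esub>) \<odot>\<^bsub>M\<^esub> v i else \<zero>\<^bsub>M\<^esub>"])
        (auto simp: direct_sum_def M.smult_minus_one M.M.l_neg cong: conj_cong)
  qed (auto simp: direct_sum_def M.M.a_ac fin_add cong: conj_cong)
  then show ?thesis
    using M.R.ring_axioms
    by (intro left_module.intro left_module_axioms.intro)
       (auto simp: direct_sum_def M.smult_l_distr M.smult_r_distr M.smult_assoc1 fin_smult
          cong: conj_cong)
qed

lemma UNION_ordLeq:
  assumes "infinite (UNIV :: 'v set)" "\<exists>j :: 'x \<Rightarrow> 'v. inj_on j A" "\<And>x. x \<in> A \<Longrightarrow> finite (F x)"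
  shows "\<exists>j :: 'i \<Rightarrow> 'v. inj_on j (\<Union>x\<in>A. F x)"
proof -
  have "(card_of (A), card_of (UNIV :: 'v set)) \<in> ordLeq"
    using assms(2) card_of_ordLeq by auto
  moreover have "\<forall>x\<in>A. (card_of (F x), card_of (UNIV :: 'v set)) \<in> ordLeq"
    using assms(1,3) card_of_ordLeq_infinite by (metis card_of_Well_order ordLeq_total)
  ultimately have "(card_of (\<Union>x\<in>A. F x), card_of (UNIV :: 'v set)) \<in> ordLeq"
    using card_of_UNION_ordLeq_infinite[OF assms(1)] by blast
  then show ?thesis using card_of_ordLeq[of "\<Union>x\<in>A. F x" "UNIV :: 'v set"] by auto
qed

lemma inj_pair:
  assumes "infinite (UNIV :: 'v set)"
  shows "\<exists>h :: 'v \<times> 'v \<Rightarrow> 'v. inj h"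
proof -
  have "(card_of (UNIV \<times> UNIV :: ('v \<times> 'v) set), card_of (UNIV :: 'v set)) \<in> ordLeq"
    using card_of_Times_same_infinite[OF assms] ordIso_imp_ordLeq by blast
  then show ?thesis using card_of_ordLeq[of "UNIV \<times> UNIV :: ('v \<times> 'v) set" "UNIV :: 'v set"] by auto
qed

lemma inj_list:
  assumes "infinite (UNIV :: 'v set)"
  shows "\<exists>h :: 'v list \<Rightarrow> 'v. inj h"
proof -
  obtain h :: "'v \<times> 'v \<Rightarrow> 'v" where h: "inj h" using inj_pair[OF assms] by blast
  obtain c :: "nat \<Rightarrow> 'v" where c: "inj c" using infinite_countable_subset[OF assms] by blast
  define g where "g l = foldr (\<lambda>x y. h (x, y)) l (c 0)" for l
  have "g k = g l \<Longrightarrow> length k = length l \<Longrightarrow> k = l" for k l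
    by (induction k l rule: list_induct2') (auto simp: g_def inj_eq[OF h])
  then have "inj (\<lambda>l. h (c (length l), g l))"
    by (intro injI) (auto simp: inj_eq[OF h] inj_eq[OF c])
  then show ?thesis by blast
qed

lemma inj_on_image:
  fixes j :: "'a \<Rightarrow> 'v"
  assumes "inj_on j A" shows "\<exists>k :: 'b \<Rightarrow> 'v. inj_on k (f ` A)"
proof
  show "inj_on (\<lambda>y. j (inv_into A f y)) (f ` A)"
    by (rule inj_onI) (metis assms f_inv_into_f inj_onD inv_into_into)
qed

text \<open>A quotient of a direct sum of copies of \<open>M\<close> that covers a set \<open>A\<close> can be
  cut down to an index set no larger than \<open>A\<close>.\<close>

lemma small_support:
  assumes inf: "infinite (UNIV :: 'v set)" and A: "\<exists>j :: 'x \<Rightarrow> 'v. inj_on j A"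
    and cover: "A \<subseteq> p ` carrier (direct_sum I M)"
  shows "\<exists>I' \<subseteq> I. (\<exists>j :: 'i \<Rightarrow> 'v. inj_on j I') \<and> A \<subseteq> p ` carrier (direct_sum I' M)"
proof -
  have "\<forall>x\<in>A. \<exists>v. v \<in> carrier (direct_sum I M) \<and> p v = x" using cover by blast
  then obtain v where v: "\<And>x. x \<in> A \<Longrightarrow> v x \<in> carrier (direct_sum I M)" "\<And>x. x \<in> A \<Longrightarrow> p (v x) = x"
    by metis
  define S where "S x = {i \<in> I. v x i \<noteq> \<zero>\<^bsub>M\<^esub>}" for x
  have "finite (S x)" if "x \<in> A" for x
    using v(1)[OF that] by (auto simp: direct_sum_def S_def)
  then have "\<exists>j :: 'i \<Rightarrow> 'v. inj_on j (\<Union>x\<in>A. S x)" using UNION_ordLeq[OF inf A] by blast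
  moreover have "v x \<in> carrier (direct_sum (\<Union>x\<in>A. S x) M)" if "x \<in> A" for x
  proof -
    have "{i \<in> (\<Union>x\<in>A. S x). v x i \<noteq> \<zero>\<^bsub>M\<^esub>} \<subseteq> {i \<in> I. v x i \<noteq> \<zero>\<^bsub>M\<^esub>}" by (auto simp: S_def)
    then show ?thesis
      using v(1)[OF that] that by (auto simp: direct_sum_def S_def intro: finite_subset)
  qed
  ultimately show ?thesis
    using v(2) by (intro exI[of _ "\<Union>x\<in>A. S x"]) (force simp: S_def)
qed

lemma direct_sum_restrict_hom:
  assumes "left_module R M" "I' \<subseteq> I" "p \<in> mod_hom R (direct_sum I M) X"
  shows "p \<in> mod_hom R (direct_sum I' M) X"
proof -
  interpret M: left_module R M by fact
  have sub: "v \<in> carrier (direct_sum I M)" if "v \<in> carrier (direct_sum I' M)" for v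
  proof -
    have "{i \<in> I. v i \<noteq> \<zero>\<^bsub>M\<^esub>} = {i \<in> I'. v i \<noteq> \<zero>\<^bsub>M\<^esub>}"
      using that assms(2) by (auto simp: direct_sum_def)
    moreover have "v i \<in> carrier M" for i
      using that by (cases "i \<in> I'") (auto simp: direct_sum_def)
    ultimately show ?thesis using that assms(2) by (auto simp: direct_sum_def)
  qed
  have add: "v \<oplus>\<^bsub>direct_sum I' M\<^esub> w = v \<oplus>\<^bsub>direct_sum I M\<^esub> w"
    if "v \<in> carrier (direct_sum I' M)" "w \<in> carrier (direct_sum I' M)" for v w
    using that assms(2) by (auto simp: direct_sum_def fun_eq_iff)
  have smult: "r \<odot>\<^bsub>direct_sum I' M\<^esub> v = r \<odot>\<^bsub>direct_sum I M\<^esub> v"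
    if "r \<in> carrier R" "v \<in> carrier (direct_sum I' M)" for v r
    using that assms(2) by (auto simp: direct_sum_def fun_eq_iff)
  show ?thesis
    using mod_homD[OF assms(3)] sub add smult by (intro mod_homI) simp_all
qed

lemma reindex_carrier:
  assumes "left_module R M" "inj_on j I"
  shows "(\<lambda>w i. if i \<in> I then w (j i) else \<zero>\<^bsub>M\<^esub>) ` carrier (direct_sum (j ` I) M) = carrier (direct_sum I M)"
    (is "?F ` _ = _")
proof -
  have "?F w \<in> carrier (direct_sum I M)" if w: "w \<in> carrier (direct_sum (j ` I) M)" for w
  proof -
    have "j ` {i \<in> I. w (j i) \<noteq> \<zero>\<^bsub>M\<^esub>} \<subseteq> {k \<in> j ` I. w k \<noteq> \<zero>\<^bsub>M\<^esub>}" by auto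
    then have "finite (j ` {i \<in> I. w (j i) \<noteq> \<zero>\<^bsub>M\<^esub>})"
      using w by (auto simp: direct_sum_def intro: finite_subset)
    then have "finite {i \<in> I. w (j i) \<noteq> \<zero>\<^bsub>M\<^esub>}"
      by (rule finite_imageD) (rule inj_on_subset[OF assms(2)], auto)
    then show ?thesis using w by (auto simp: direct_sum_def cong: conj_cong)
  qed
  moreover have "v \<in> ?F ` carrier (direct_sum (j ` I) M)" if v: "v \<in> carrier (direct_sum I M)" for v
  proof
    let ?w = "\<lambda>k. if k \<in> j ` I then v (inv_into I j k) else \<zero>\<^bsub>M\<^esub>"
    show "v = ?F ?w" using v assms(2) by (auto simp: direct_sum_def)
    have "{k \<in> j ` I. ?w k \<noteq> \<zero>\<^bsub>M\<^esub>} \<subseteq> j ` {i \<in> I. v i \<noteq> \<zero>\<^bsub>M\<^esub>}"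
      using assms(2) by auto
    then have "finite {k \<in> j ` I. ?w k \<noteq> \<zero>\<^bsub>M\<^esub>}"
      by (rule finite_subset) (use v in \<open>simp add: direct_sum_def\<close>)
    then show "?w \<in> carrier (direct_sum (j ` I) M)"
      using v assms(2) unfolding direct_sum_def by simp
  qed
  ultimately show ?thesis by blast
qed

lemma reindex_generated:
  fixes j :: "'i \<Rightarrow> 'v"
  assumes M: "left_module R M" and j: "inj_on j I" and p: "p \<in> mod_hom R (direct_sum I M) X"
    and onto: "p ` carrier (direct_sum I M) = carrier X"
  shows "M_generated TYPE('v) R M X"
proof -
  let ?F = "\<lambda>w i. if i \<in> I then w (j i) else \<zero>\<^bsub>M\<^esub>"
  note F = reindex_carrier[OF M j]
  have "?F \<in> mod_hom R (direct_sum (j ` I) M) (direct_sum I M)"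
  proof (rule mod_homI)
    show "?F w \<in> carrier (direct_sum I M)" if "w \<in> carrier (direct_sum (j ` I) M)" for w
      using F that by blast
  qed (auto simp: direct_sum_def)
  then have "(\<lambda>w. p (?F w)) \<in> mod_hom R (direct_sum (j ` I) M) X" by (rule mod_hom_comp[OF _ p])
  moreover have "(\<lambda>w. p (?F w)) ` carrier (direct_sum (j ` I) M) = carrier X"
    using F onto by (metis image_image)
  ultimately show ?thesis unfolding M_generated_def by blast
qed

lemma M_generated_universe:
  assumes M: "left_module R M"
    and inf: "infinite (UNIV :: 'v set)" and X: "\<exists>j :: 'x \<Rightarrow> 'v. inj_on j (carrier X)"
    and gen: "M_generated TYPE('u) R M X"
  shows "M_generated TYPE('v) R M X"
proof -
  obtain I :: "'u set" and p where
    p: "p \<in> mod_hom R (direct_sum I M) X" "p ` carrier (direct_sum I M) = carrier X"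
    using gen unfolding M_generated_def by blast
  obtain I' and j :: "'u \<Rightarrow> 'v" where I': "I' \<subseteq> I" "inj_on j I'"
      "carrier X \<subseteq> p ` carrier (direct_sum I' M)"
    using small_support[OF inf X, of p I M] p(2) by blast
  have p': "p \<in> mod_hom R (direct_sum I' M) X"
    by (rule direct_sum_restrict_hom[OF M I'(1) p(1)])
  have "p ` carrier (direct_sum I' M) \<subseteq> carrier X"
    using mod_homD(1)[OF p'] by (rule image_subsetI)
  then have "p ` carrier (direct_sum I' M) = carrier X"
    using I'(3) by (rule subset_antisym)
  then show ?thesis by (rule reindex_generated[OF M I'(2) p'])
qed

lemma inj_direct_sum:
  assumes inf: "infinite (UNIV :: 'v set)" and I: "inj_on (j :: 'i \<Rightarrow> 'v) I"
    and M: "inj_on (k :: 'm \<Rightarrow> 'v) (carrier M)"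
  shows "\<exists>h :: ('i \<Rightarrow> 'm) \<Rightarrow> 'v. inj_on h (carrier (direct_sum I M))"
proof -
  obtain h :: "'v list \<Rightarrow> 'v" where h: "inj h" using inj_list[OF inf] by blast
  obtain g :: "'v \<times> 'v \<Rightarrow> 'v" where g: "inj g" using inj_pair[OF inf] by blast
  define q where "q = (\<lambda>(i, m). g (j i, k m))"
  have q: "inj_on q (I \<times> carrier M)"
    by (intro inj_onI) (auto simp: q_def inj_eq[OF g] dest: inj_onD[OF I] inj_onD[OF M])
  define G where "G v = (\<lambda>i. (i, v i)) ` {i \<in> I. v i \<noteq> \<zero>\<^bsub>M\<^esub>}" for v
  have Gsub: "G v \<subseteq> I \<times> carrier M" if "v \<in> carrier (direct_sum I M)" for v
    using that by (auto simp: direct_sum_def G_def)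
  have "\<exists>xs. set xs = q ` G v" if "v \<in> carrier (direct_sum I M)" for v
    using that by (intro finite_list) (simp add: direct_sum_def G_def)
  then obtain e where e: "\<And>v. v \<in> carrier (direct_sum I M) \<Longrightarrow> set (e v) = q ` G v" by metis
  have "inj_on (\<lambda>v. h (e v)) (carrier (direct_sum I M))"
  proof (rule inj_onI)
    fix v w assume v: "v \<in> carrier (direct_sum I M)" and w: "w \<in> carrier (direct_sum I M)"
      and "h (e v) = h (e w)"
    then have "q ` G v = q ` G w" using e inj_eq[OF h] by metis
    then have G: "G v = G w" using inj_on_image_eq_iff[OF q Gsub[OF v] Gsub[OF w]] by simp
    have supp: "i \<in> I \<and> v i \<noteq> \<zero>\<^bsub>M\<^esub> \<longleftrightarrow> (i, v i) \<in> G v" "i \<in> I \<and> w i \<noteq> \<zero>\<^bsub>M\<^esub> \<longleftrightarrow> (i, w i) \<in> G w" for i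
      by (auto simp: G_def)
    have val: "v i = m" if "(i, m) \<in> G v" for i m using that by (auto simp: G_def)
    have val': "w i = m" if "(i, m) \<in> G w" for i m using that by (auto simp: G_def)
    have out: "v i = \<zero>\<^bsub>M\<^esub>" "w i = \<zero>\<^bsub>M\<^esub>" if "i \<notin> I" for i
      using v w that by (auto simp: direct_sum_def)
    show "v = w"
    proof
      fix i
      show "v i = w i"
        using supp[of i] val[of i "w i"] val'[of i "v i"] out[of i] unfolding G by metis
    qed
  qed
  then show ?thesis by blast
qed

lemma in_sigma_universe:
  fixes X :: "('r, 'x, 'c) module_scheme"
  assumes M: "left_module R M"
    and inf: "infinite (UNIV :: 'v set)"
    and jX: "\<exists>j :: 'x \<Rightarrow> 'v. inj_on j (carrier X)" and jM: "inj_on (k :: 'm \<Rightarrow> 'v) (carrier M)"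
    and X: "in_sigma TYPE('u) R M X"
  shows "in_sigma TYPE('v) R M X"
proof -
  obtain Q :: "('r, 'u) module" and e where
    LX: "left_module R X" and Q: "left_module R Q" and gen: "M_generated TYPE('u) R M Q"
    and e: "e \<in> mod_hom R X Q" "inj_on e (carrier X)"
    using X unfolding in_sigma_def by blast
  obtain I :: "'u set" and p where
    p: "p \<in> mod_hom R (direct_sum I M) Q" "p ` carrier (direct_sum I M) = carrier Q"
    using gen unfolding M_generated_def by blast
  have "\<exists>j :: 'u \<Rightarrow> 'v. inj_on j (e ` carrier X)" using jX inj_on_image by blast
  moreover have "e ` carrier X \<subseteq> p ` carrier (direct_sum I M)"
    using p(2) mod_homD(1)[OF e(1)] by blast
  ultimately obtain I' and j :: "'u \<Rightarrow> 'v" where I': "I' \<subseteq> I" "inj_on j I'"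
      "e ` carrier X \<subseteq> p ` carrier (direct_sum I' M)"
    using small_support[OF inf, of "e ` carrier X" p I M] by blast
  have p': "p \<in> mod_hom R (direct_sum I' M) Q"
    by (rule direct_sum_restrict_hom[OF M I'(1) p(1)])
  define N where "N = p ` carrier (direct_sum I' M)"
  have LN: "left_module R (Q\<lparr>carrier := N\<rparr>)"
    using left_module.submodule_left_module[OF Q image_submodule[OF p' direct_sum_left_module[OF M] Q]]
    unfolding N_def .
  obtain h :: "('u \<Rightarrow> 'm) \<Rightarrow> 'v" where "inj_on h (carrier (direct_sum I' M))"
    using inj_direct_sum[OF inf I'(2) jM] by blast
  then obtain t :: "'u \<Rightarrow> 'v" where t: "inj_on t N"
    using inj_on_image unfolding N_def by blast
  let ?Q = "transport t (Q\<lparr>carrier := N\<rparr>)"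
  have tN: "inj_on t (carrier (Q\<lparr>carrier := N\<rparr>))" using t by simp
  note th = transport_hom[OF LN tN]
  have "p \<in> mod_hom R (direct_sum I' M) (Q\<lparr>carrier := N\<rparr>)"
    using p' by (auto simp: mod_hom_def N_def)
  then have "(\<lambda>x. t (p x)) \<in> mod_hom R (direct_sum I' M) ?Q"
    by (rule mod_hom_comp[OF _ th])
  moreover have "(\<lambda>x. t (p x)) ` carrier (direct_sum I' M) = carrier ?Q"
    by (simp add: transport_def N_def image_image)
  ultimately have "M_generated TYPE('v) R M ?Q" by (rule reindex_generated[OF M I'(2)])
  moreover have "e \<in> mod_hom R X (Q\<lparr>carrier := N\<rparr>)"
    using e(1) I'(3) by (auto simp: mod_hom_def N_def)
  then have "(\<lambda>x. t (e x)) \<in> mod_hom R X ?Q" by (rule mod_hom_comp[OF _ th])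
  moreover have "inj_on (\<lambda>x. t (e x)) (carrier X)"
    using comp_inj_on[OF e(2) inj_on_subset[OF t I'(3)[folded N_def]]] by (simp add: comp_def)
  ultimately show ?thesis
    unfolding in_sigma_def using LX transport_left_module[OF LN tN]
    by (intro conjI exI[of _ ?Q] exI[of _ "\<lambda>x. t (e x)"]) simp_all
qed

lemma in_sigma_embed:
  fixes R :: "('r, 'a) ring_scheme"
  assumes "in_sigma TYPE('u) R M X" "left_module R Z" "f \<in> mod_hom R Z X" "inj_on f (carrier Z)"
  shows "in_sigma TYPE('u) R M Z"
proof -
  obtain Q :: "('r, 'u) module" and e where
    "left_module R Q" "M_generated TYPE('u) R M Q" "e \<in> mod_hom R X Q" "inj_on e (carrier X)"
    using assms(1) unfolding in_sigma_def by blast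
  moreover from this have "(\<lambda>z. e (f z)) \<in> mod_hom R Z Q"
    using mod_hom_comp[OF assms(3)] by blast
  moreover from calculation have "inj_on (\<lambda>z. e (f z)) (carrier Z)"
    using assms(4) mod_homD(1)[OF assms(3)] by (auto simp: inj_on_def)
  ultimately show ?thesis unfolding in_sigma_def using assms(2) by blast
qed

text \<open>The submodule generated by a family indexed by \<open>M\<close> is an image of
  a set of lists over \<open>R \<times> M\<close>.\<close>

lemma generated_submodule:
  fixes R :: "('r, 'a) ring_scheme" and X :: "('r, 'x, 'c) module_scheme" and s :: "'m \<Rightarrow> 'x"
  assumes X: "left_module R X" and s: "\<And>m. m \<in> A \<Longrightarrow> s m \<in> carrier X"
  shows "\<exists>N. submodule N R X \<and> s ` A \<subseteq> N \<and> (\<exists>j :: 'x \<Rightarrow> ('r \<times> 'm) list. inj_on j N)"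
proof -
  interpret X: left_module R X by fact
  define S where "S l = foldr (\<lambda>(r, m) y. r \<odot>\<^bsub>X\<^esub> s m \<oplus>\<^bsub>X\<^esub> y) l \<zero>\<^bsub>X\<^esub>" for l
  define L where "L = lists (carrier R \<times> A)"
  have cl: "S l \<in> carrier X" if "l \<in> L" for l
    using that unfolding L_def by (induction l) (auto simp: S_def s)
  have app: "S (k @ l) = S k \<oplus>\<^bsub>X\<^esub> S l" if "k \<in> L" "l \<in> L" for k l
    using that(1) unfolding L_def
  proof (induction k)
    case Nil then show ?case using cl[OF that(2)] by (simp add: S_def)
  next
    case (Cons a k)
    then have "S k \<in> carrier X" using cl L_def by blast
    then show ?case using Cons cl[OF that(2)] s by (auto simp: S_def X.M.a_assoc)
  qed
  have sm: "S (map (\<lambda>(r, m). (a \<otimes>\<^bsub>R\<^esub> r, m)) l) = a \<odot>\<^bsub>X\<^esub> S l"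
    if "a \<in> carrier R" "l \<in> L" for a l
    using that(2) unfolding L_def
  proof (induction l)
    case Nil then show ?case using that(1) by (simp add: S_def)
  next
    case (Cons b l)
    then have "S l \<in> carrier X" using cl L_def by blast
    then show ?case using Cons that(1) s by (auto simp: S_def X.smult_r_distr X.smult_assoc1)
  qed
  have "submodule (S ` L) R X"
  proof (rule X.left_submoduleI)
    show "S ` L \<subseteq> carrier X" using cl by blast
    have "S [] = \<zero>\<^bsub>X\<^esub>" "[] \<in> L" by (auto simp: S_def L_def)
    then show "\<zero>\<^bsub>X\<^esub> \<in> S ` L" by (metis imageI)
    show "x \<oplus>\<^bsub>X\<^esub> y \<in> S ` L" if xy: "x \<in> S ` L" "y \<in> S ` L" for x y
    proof -
      obtain k l where kl: "k \<in> L" "l \<in> L" "x = S k" "y = S l" using xy by blast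
      have "k @ l \<in> L" using kl(1,2) by (simp add: L_def)
      then show ?thesis using app[OF kl(1,2)] kl(3,4) by (metis imageI)
    qed
    show "a \<odot>\<^bsub>X\<^esub> x \<in> S ` L" if a: "a \<in> carrier R" and x: "x \<in> S ` L" for a x
    proof -
      obtain l where l: "l \<in> L" "x = S l" using x by blast
      have "map (\<lambda>(r, m). (a \<otimes>\<^bsub>R\<^esub> r, m)) l \<in> L" using l(1) a by (fastforce simp: L_def)
      then show ?thesis using sm[OF a l(1)] l(2) by (metis imageI)
    qed
  qed
  moreover have "s m \<in> S ` L" if "m \<in> A" for m
  proof
    show "[(\<one>\<^bsub>R\<^esub>, m)] \<in> L" using that by (simp add: L_def)
    show "s m = S [(\<one>\<^bsub>R\<^esub>, m)]" using s[OF that] by (simp add: S_def)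
  qed
  moreover have "\<exists>j :: 'x \<Rightarrow> ('r \<times> 'm) list. inj_on j (S ` L)"
    using inj_on_image[OF inj_on_id, of S L] inj_on_inv_into by blast
  ultimately show ?thesis by blast
qed

lemma projective_in_sigma_universe:
  fixes R :: "('r, 'a) ring_scheme" and M :: "('r, 'm, 'b) module_scheme"
  assumes M: "left_module R M" and proj: "projective_in_sigma TYPE(('r \<times> 'm) list) R M"
  shows "projective_in_sigma TYPE('u) R M"
  unfolding projective_in_sigma_def
proof (intro allI impI ballI)
  fix X Y :: "('r, 'u) module" and p f
  assume sX: "in_sigma TYPE('u) R M X" and sY: "in_sigma TYPE('u) R M Y"
    and p: "p \<in> mod_hom R X Y" and onto: "p ` carrier X = carrier Y" and f: "f \<in> mod_hom R M Y"
  have X: "left_module R X" and Y: "left_module R Y" using sX sY by (auto simp: in_sigma_def)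
  have inf: "infinite (UNIV :: ('r \<times> 'm) list set)" by (rule infinite_UNIV_listI)
  have "inj (\<lambda>m. [(undefined :: 'r, m :: 'm)])" by (simp add: inj_def)
  then have jM: "inj_on (\<lambda>m. [(undefined :: 'r, m)]) (carrier M)" by (rule inj_on_subset) simp
  have "\<forall>m\<in>carrier M. \<exists>x\<in>carrier X. p x = f m"
    using onto mod_homD(1)[OF f] by (metis imageE)
  then obtain s where s: "\<And>m. m \<in> carrier M \<Longrightarrow> s m \<in> carrier X"
      "\<And>m. m \<in> carrier M \<Longrightarrow> p (s m) = f m" by metis
  obtain N and j :: "'u \<Rightarrow> ('r \<times> 'm) list" where
    N: "submodule N R X" and sN: "s ` carrier M \<subseteq> N" and j: "inj_on j N"
    using generated_submodule[where A = "carrier M" and s = s, OF X s(1)] by blast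
  let ?X = "X\<lparr>carrier := N\<rparr>"
  have LX: "left_module R ?X" by (rule left_module.submodule_left_module[OF X N])
  have Nsub: "N \<subseteq> carrier X"
    using subgroup.subset[OF submodule.axioms(1)[OF N]] by simp
  have iX: "(\<lambda>x. x) \<in> mod_hom R ?X X" using Nsub by (intro mod_homI) auto
  have pX: "p \<in> mod_hom R ?X Y" using mod_hom_comp[OF iX p] .
  have PN: "submodule (p ` N) R Y" using image_submodule[OF pX LX Y] by simp
  let ?Y = "Y\<lparr>carrier := p ` N\<rparr>"
  have LY: "left_module R ?Y" by (rule left_module.submodule_left_module[OF Y PN])
  have PNsub: "p ` N \<subseteq> carrier Y"
    using subgroup.subset[OF submodule.axioms(1)[OF PN]] by simp
  have iY: "(\<lambda>x. x) \<in> mod_hom R ?Y Y" using PNsub by (intro mod_homI) auto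
  obtain k :: "'u \<Rightarrow> ('r \<times> 'm) list" where k: "inj_on k (p ` N)"
    using inj_on_image[OF j] by blast
  have j': "inj_on j (carrier ?X)" and k': "inj_on k (carrier ?Y)" using j k by auto
  let ?TX = "transport j ?X" and ?TY = "transport k ?Y"
  let ?jinv = "inv_into (carrier ?X) j" and ?kinv = "inv_into (carrier ?Y) k"
  have injinv: "inj_on ?jinv (carrier ?TX)" "inj_on ?kinv (carrier ?TY)"
    by (auto simp: transport_def intro!: inj_on_inv_into)
  have "in_sigma TYPE('u) R M ?TX"
    using in_sigma_embed[OF sX transport_left_module[OF LX j']]
      mod_hom_comp[OF transport_inv_hom[OF LX j'] iX] injinv(1) by blast
  then have TX: "in_sigma TYPE(('r \<times> 'm) list) R M ?TX"
    by (intro in_sigma_universe[OF M inf _ jM]) (auto intro: exI[of _ "\<lambda>x. x"])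
  have "in_sigma TYPE('u) R M ?TY"
    using in_sigma_embed[OF sY transport_left_module[OF LY k']]
      mod_hom_comp[OF transport_inv_hom[OF LY k'] iY] injinv(2) by blast
  then have TY: "in_sigma TYPE(('r \<times> 'm) list) R M ?TY"
    by (intro in_sigma_universe[OF M inf _ jM]) (auto intro: exI[of _ "\<lambda>x. x"])
  have pXY: "p \<in> mod_hom R ?X ?Y" using pX by (auto simp: mod_hom_def)
  let ?p = "\<lambda>x. k (p (?jinv x))"
  have hp: "?p \<in> mod_hom R ?TX ?TY"
    by (rule mod_hom_comp[OF mod_hom_comp[OF transport_inv_hom[OF LX j'] pXY] transport_hom[OF LY k']])
  have op: "?p ` carrier ?TX = carrier ?TY"
    using j by (force simp: transport_def image_image)
  have fN: "f m \<in> p ` N" if "m \<in> carrier M" for m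
    using s(2)[OF that] sN that by (metis imageI subsetD)
  have "f \<in> mod_hom R M ?Y" using f fN by (auto simp: mod_hom_def)
  then have kf: "(\<lambda>m. k (f m)) \<in> mod_hom R M ?TY" by (rule mod_hom_comp[OF _ transport_hom[OF LY k']])
  have "\<forall>f\<in>mod_hom R M ?TY. \<exists>g\<in>mod_hom R M ?TX. \<forall>m\<in>carrier M. ?p (g m) = f m"
    using proj[unfolded projective_in_sigma_def, rule_format, OF TX TY hp op] by (intro ballI)
  from bspec[OF this kf] obtain g where
    g: "g \<in> mod_hom R M ?TX" and pg: "\<forall>m\<in>carrier M. ?p (g m) = k (f m)" ..
  define h where "h = (\<lambda>m. ?jinv (g m))"
  have hX: "h \<in> mod_hom R M ?X"
    unfolding h_def by (rule mod_hom_comp[OF g transport_inv_hom[OF LX j']])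
  have "p (h m) = f m" if m: "m \<in> carrier M" for m
  proof (rule inj_onD[OF k])
    show "k (p (h m)) = k (f m)" unfolding h_def by (rule bspec[OF pg m])
    show "p (h m) \<in> p ` N" using mod_homD(1)[OF hX m] by simp
    show "f m \<in> p ` N" by (rule fN[OF m])
  qed
  moreover have "h \<in> mod_hom R M X" using mod_hom_comp[OF hX iX] .
  ultimately show "\<exists>g\<in>mod_hom R M X. \<forall>m\<in>carrier M. p (g m) = f m" by blast
qed

end

theory Submission
  imports Defs
begin

text \<open>For fully invariant \<open>A\<close>, \<open>I\<close> with \<open>A + I = M\<close>, every submodule \<open>K\<close> is
  \<open>(A \<inter> K) + (I \<inter> K)\<close>, because \<open>K\<close> is generated by images of \<open>M\<close>. Projectivity gives
  \<open>Ann(Rx) \<inter> Ann(Ry) \<subseteq> Ann(R(x + y))\<close>. Together these show that \<open>\<Psi>(M)\<close> is closed under binary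
  intersections and arbitrary sums, and that intersections distribute over sums. Spatiality
  then needs no prime submodules: the elements of \<open>\<Psi>(M)\<close> that are maximal among those
  avoiding a given element of \<open>M\<close> are points, by distributivity.\<close>

section \<open>Lifting and generation\<close>

lemma mod_hom_submodule_carrier:
  assumes "N \<subseteq> carrier Y"
  shows "f \<in> mod_hom R X (Y\<lparr>carrier := N\<rparr>) \<longleftrightarrow> f \<in> mod_hom R X Y \<and> f ` carrier X \<subseteq> N"
  using assms by (auto simp: mod_hom_def)

lemma submodule_subset: "submodule N R M \<Longrightarrow> N \<subseteq> carrier M"
  using subgroup.subset[OF submodule.axioms(1)] by fastforce

lemma submodule_zero: "submodule N R M \<Longrightarrow> \<zero>\<^bsub>M\<^esub> \<in> N"
  using subgroup.one_closed[OF submodule.axioms(1)] by fastforce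

lemma submodule_add:
  "submodule N R M \<Longrightarrow> x \<in> N \<Longrightarrow> y \<in> N \<Longrightarrow> x \<oplus>\<^bsub>M\<^esub> y \<in> N"
  using subgroup.m_closed[OF submodule.axioms(1)] by fastforce

lemma fully_invariant_submodule: "fully_invariant R M N \<Longrightarrow> submodule N R M"
  by (simp add: fully_invariant_def)

lemma fully_invariantD:
  "\<lbrakk>fully_invariant R M N; f \<in> mod_hom R M M; x \<in> N\<rbrakk> \<Longrightarrow> f x \<in> N"
  by (auto simp: fully_invariant_def)

lemma set_add_memE:
  assumes "z \<in> A <+>\<^bsub>G\<^esub> B"
  obtains a b where "a \<in> A" "b \<in> B" "z = a \<oplus>\<^bsub>G\<^esub> b"
  using assms by (auto simp: set_add_def')

lemma set_add_memI: "\<lbrakk>a \<in> A; b \<in> B; z = a \<oplus>\<^bsub>G\<^esub> b\<rbrakk> \<Longrightarrow> z \<in> A <+>\<^bsub>G\<^esub> B"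
  by (auto simp: set_add_def')

text \<open>The direct sum itself is the \<open>M\<close>-generated module into which
  \<open>X\<close> embeds. The universe has to hold both its elements and the index set, hence the
  product type; the component not in use is filled with \<open>undefined\<close>.\<close>

lemma in_sigma_direct_sum_embed:
  fixes X :: "('r, 'x, 'c) module_scheme" and I :: "'i set" and M :: "('r, 'm, 'b) module_scheme"
  assumes M: "left_module R M" and X: "left_module R X"
    and e: "e \<in> mod_hom R X (direct_sum I M)" "inj_on e (carrier X)"
  shows "in_sigma TYPE(('i \<Rightarrow> 'm) \<times> 'i) R M X"
proof -
  let ?D = "direct_sum I M" and ?t = "\<lambda>v :: 'i \<Rightarrow> 'm. (v, undefined :: 'i)"
  have t: "inj_on ?t (carrier ?D)" by (simp add: inj_on_def)
  note D = direct_sum_left_module[OF M, of I]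
  have "inj_on (\<lambda>i. (undefined :: 'i \<Rightarrow> 'm, i)) I" by (simp add: inj_on_def)
  then have "M_generated TYPE(('i \<Rightarrow> 'm) \<times> 'i) R M (transport ?t ?D)"
    by (rule reindex_generated[OF M _ transport_hom[OF D t]]) (simp add: transport_def)
  moreover have "inj_on (\<lambda>x. ?t (e x)) (carrier X)" using e(2) by (simp add: inj_on_def)
  ultimately show ?thesis
    using X transport_left_module[OF D t] mod_hom_comp[OF e(1) transport_hom[OF D t]]
    unfolding in_sigma_def by blast
qed

text \<open>Projectivity speaks of modules over one type only. Embedding \<open>X\<close> and
  \<open>Y\<close> into the same direct sum puts both into \<open>\<sigma>[M]\<close> and supplies
  injections into a common type, along which the lifting problem is transported and its solution
  carried back.\<close>

lemma projective_lift:
  fixes M :: "('r, 'm, 'b) module_scheme" and I :: "'i set"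
    and X :: "('r, 'x, 'c) module_scheme" and Y :: "('r, 'y, 'd) module_scheme"
  assumes M: "left_module R M" and proj: "projective_in_sigma TYPE(('r \<times> 'm) list) R M"
    and X: "left_module R X" "e \<in> mod_hom R X (direct_sum I M)" "inj_on e (carrier X)"
    and Y: "left_module R Y" "e' \<in> mod_hom R Y (direct_sum I M)" "inj_on e' (carrier Y)"
    and p: "p \<in> mod_hom R X Y" "p ` carrier X = carrier Y" and f: "f \<in> mod_hom R M Y"
  obtains g where "g \<in> mod_hom R M X" "\<And>m. m \<in> carrier M \<Longrightarrow> p (g m) = f m"
proof -
  \<comment> \<open>The embeddings themselves, padded by a dummy component, serve as the transport
    maps.\<close>
  let ?s = "\<lambda>x. (e x, undefined :: 'i)" and ?t = "\<lambda>y. (e' y, undefined :: 'i)"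
  have s: "inj_on ?s (carrier X)" and t: "inj_on ?t (carrier Y)"
    using X(3) Y(3) by (simp_all add: inj_on_def)
  let ?X = "transport ?s X" and ?Y = "transport ?t Y"
  let ?i = "inv_into (carrier X) ?s"
  note si = transport_inv_hom[OF X(1) s] and ti = transport_inv_hom[OF Y(1) t]
  have injs: "inj_on ?i (carrier ?X)" "inj_on (inv_into (carrier Y) ?t) (carrier ?Y)"
    by (auto simp: transport_def intro!: inj_on_inv_into)
  have sX: "in_sigma TYPE(('i \<Rightarrow> 'm) \<times> 'i) R M ?X"
    by (rule in_sigma_embed[OF in_sigma_direct_sum_embed[OF M X]
          transport_left_module[OF X(1) s] si injs(1)])
  have sY: "in_sigma TYPE(('i \<Rightarrow> 'm) \<times> 'i) R M ?Y"
    by (rule in_sigma_embed[OF in_sigma_direct_sum_embed[OF M Y]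
          transport_left_module[OF Y(1) t] ti injs(2)])
  let ?p = "\<lambda>x. ?t (p (?i x))"
  have hp: "?p \<in> mod_hom R ?X ?Y"
    by (rule mod_hom_comp[OF mod_hom_comp[OF si p(1)] transport_hom[OF Y(1) t]])
  have "?p ` carrier ?X = ?t ` p ` ?i ` carrier ?X" by (simp only: image_image)
  also have "?i ` carrier ?X = carrier X" using s by (simp add: transport_def)
  finally have op: "?p ` carrier ?X = carrier ?Y" using p(2) by (simp add: transport_def)
  have hf: "(\<lambda>m. ?t (f m)) \<in> mod_hom R M ?Y"
    by (rule mod_hom_comp[OF f transport_hom[OF Y(1) t]])
  note proj' = projective_in_sigma_universe[where 'u = "('i \<Rightarrow> 'm) \<times> 'i", OF M proj]
  have "\<forall>f\<in>mod_hom R M ?Y. \<exists>g\<in>mod_hom R M ?X. \<forall>m\<in>carrier M. ?p (g m) = f m"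
    using proj'[unfolded projective_in_sigma_def, rule_format, OF sX sY hp op] by (intro ballI)
  from bspec[OF this hf] obtain g where g: "g \<in> mod_hom R M ?X" "\<And>m. m \<in> carrier M \<Longrightarrow> ?p (g m) = ?t (f m)"
    by blast
  note h = mod_hom_comp[OF g(1) si]
  have "p (?i (g m)) = f m" if "m \<in> carrier M" for m
    using inj_onD[OF t g(2)[OF that]] mod_homD(1)[OF p(1) mod_homD(1)[OF h that]]
      mod_homD(1)[OF f that] by blast
  with h show thesis by (rule that)
qed

lemma direct_sum_single_hom:
  assumes M: "left_module R M" and i: "i \<in> I"
  shows "(\<lambda>m k. if k = i then m else \<zero>\<^bsub>M\<^esub>) \<in> mod_hom R M (direct_sum I M)"
proof -
  interpret M: left_module R M by fact
  have fin: "finite {k \<in> I. (if k = i then m else \<zero>\<^bsub>M\<^esub>) \<noteq> \<zero>\<^bsub>M\<^esub>}" for m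
    by (rule finite_subset[of _ "{i}"]) auto
  show ?thesis
    using i fin by (intro mod_homI) (auto simp: direct_sum_def fun_eq_iff)
qed

text \<open>An element of \<open>X\<close> is the image under \<open>p\<close> of a finitely
  supported family, hence a finite sum of elements \<open>f m\<close>, where each \<open>f\<close>
  is \<open>p\<close> composed with a coordinate inclusion of \<open>M\<close>. This turns
  \<open>M\<close>-generation into an induction principle.\<close>

lemma generated_subset:
  fixes X :: "('r, 'x, 'c) module_scheme"
  assumes M: "left_module R M" and X: "left_module R X" and gen: "M_generated TYPE('u) R M X"
    and zero: "\<zero>\<^bsub>X\<^esub> \<in> T" and add: "\<And>x y. x \<in> T \<Longrightarrow> y \<in> T \<Longrightarrow> x \<oplus>\<^bsub>X\<^esub> y \<in> T"
    and img: "\<And>f m. f \<in> mod_hom R M X \<Longrightarrow> m \<in> carrier M \<Longrightarrow> f m \<in> T"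
  shows "carrier X \<subseteq> T"
proof -
  interpret M: left_module R M by fact
  obtain I :: "'u set" and p where
    p: "p \<in> mod_hom R (direct_sum I M) X" "p ` carrier (direct_sum I M) = carrier X"
    using gen unfolding M_generated_def by blast
  let ?D = "direct_sum I M"
  note pz = mod_hom_zero[OF p(1) direct_sum_left_module[OF M] X]
  \<comment> \<open>The induction runs over a finite set that contains the support, so an index of
    \<open>F\<close> outside the support or outside \<open>I\<close> does no harm.\<close>
  have fin: "p v \<in> T" if "finite F" "v \<in> carrier ?D" "{i \<in> I. v i \<noteq> \<zero>\<^bsub>M\<^esub>} \<subseteq> F" for F v
    using that
  proof (induction F arbitrary: v rule: finite_induct)
    case empty
    then have "v = \<zero>\<^bsub>?D\<^esub>" by (auto simp: direct_sum_def fun_eq_iff)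
    then show ?case using pz zero by simp
  next
    case (insert i F)
    show ?case
    proof (cases "i \<in> I")
      case False
      then have "{i \<in> I. v i \<noteq> \<zero>\<^bsub>M\<^esub>} \<subseteq> F" using insert.prems(2) by blast
      with insert show ?thesis by blast
    next
      case True
      \<comment> \<open>The family \<open>v\<close> is split into its coordinate at \<open>i\<close>
        and the rest, whose support lies in \<open>F\<close>.\<close>
      let ?s = "\<lambda>k. if k = i then v i else \<zero>\<^bsub>M\<^esub>" and ?w = "v(i := \<zero>\<^bsub>M\<^esub>)"
      have vi: "v i \<in> carrier M" using insert.prems(1) True by (auto simp: direct_sum_def)
      note single = direct_sum_single_hom[OF M True]
      have s: "?s \<in> carrier ?D" using mod_homD(1)[OF single vi] .
      have "finite {k \<in> I. v k \<noteq> \<zero>\<^bsub>M\<^esub>}" using insert.prems(1) by (auto simp: direct_sum_def)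
      then have "finite {k \<in> I. ?w k \<noteq> \<zero>\<^bsub>M\<^esub>}" by (rule rev_finite_subset) auto
      then have w: "?w \<in> carrier ?D" using insert.prems(1) by (auto simp: direct_sum_def)
      have "p ?w \<in> T" using insert.prems(2) by (intro insert.IH[OF w]) auto
      moreover have "p ?s \<in> T" using img[OF mod_hom_comp[OF single p(1)] vi] .
      moreover have "v = ?s \<oplus>\<^bsub>?D\<^esub> ?w"
        using insert.prems(1) by (auto simp: direct_sum_def fun_eq_iff)
      ultimately show ?thesis using add mod_homD(2)[OF p(1) s w] by metis
    qed
  qed
  have "p v \<in> T" if "v \<in> carrier ?D" for v
    by (rule fin[OF _ that subset_refl]) (use that in \<open>simp add: direct_sum_def\<close>)
  then show ?thesis unfolding p(2)[symmetric] by (rule image_subsetI)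
qed

section \<open>Annihilators of cyclic submodules\<close>

abbreviation cyclic_ann ::
    "('r, 'a) ring_scheme \<Rightarrow> ('r, 'm, 'b) module_scheme \<Rightarrow> 'm \<Rightarrow> 'm set"
  where "cyclic_ann R M n \<equiv> Ann_in R M (M\<lparr>carrier := cyclic_submodule R M n\<rparr>)"

context left_module
begin

lemma cyclic_submodule_submodule:
  assumes "n \<in> carrier M"
  shows "submodule (cyclic_submodule R M n) R M"
proof (rule left_submoduleI)
  show "\<zero>\<^bsub>M\<^esub> \<in> cyclic_submodule R M n"
    using assms smult_l_null R.zero_closed unfolding cyclic_submodule_def by force
next
  fix x y assume "x \<in> cyclic_submodule R M n" "y \<in> cyclic_submodule R M n"
  then obtain r s where "r \<in> carrier R" "s \<in> carrier R" "x = r \<odot>\<^bsub>M\<^esub> n" "y = s \<odot>\<^bsub>M\<^esub> n"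
    by (auto simp: cyclic_submodule_def)
  then have "x \<oplus>\<^bsub>M\<^esub> y = (r \<oplus>\<^bsub>R\<^esub> s) \<odot>\<^bsub>M\<^esub> n" "r \<oplus>\<^bsub>R\<^esub> s \<in> carrier R"
    using assms by (simp_all add: smult_l_distr)
  then show "x \<oplus>\<^bsub>M\<^esub> y \<in> cyclic_submodule R M n" by (auto simp: cyclic_submodule_def)
next
  fix a x assume a: "a \<in> carrier R" and "x \<in> cyclic_submodule R M n"
  then obtain r where "r \<in> carrier R" "x = r \<odot>\<^bsub>M\<^esub> n"
    by (auto simp: cyclic_submodule_def)
  then have "a \<odot>\<^bsub>M\<^esub> x = (a \<otimes>\<^bsub>R\<^esub> r) \<odot>\<^bsub>M\<^esub> n" "a \<otimes>\<^bsub>R\<^esub> r \<in> carrier R"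
    using assms a by (simp_all add: smult_assoc1)
  then show "a \<odot>\<^bsub>M\<^esub> x \<in> cyclic_submodule R M n" by (auto simp: cyclic_submodule_def)
qed (use assms in \<open>auto simp: cyclic_submodule_def\<close>)

lemma cyclic_submodule_self: "n \<in> carrier M \<Longrightarrow> n \<in> cyclic_submodule R M n"
  using smult_one R.one_closed unfolding cyclic_submodule_def by force

lemma submodule_Int:
  assumes "submodule A R M" "submodule B R M"
  shows "submodule (A \<inter> B) R M"
  using assms submodule_subset[OF assms(1)]
  by (intro left_submoduleI) (auto intro: submodule_zero submodule_add submodule.smult_closed)

lemma fully_invariant_Int:
  "\<lbrakk>fully_invariant R M A; fully_invariant R M B\<rbrakk> \<Longrightarrow> fully_invariant R M (A \<inter> B)"
  unfolding fully_invariant_def using submodule_Int by blast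

lemma fully_invariant_carrier: "fully_invariant R M (carrier M)"
  unfolding fully_invariant_def
  by (auto intro: left_submoduleI simp: mod_hom_def)

text \<open>The zero homomorphism shows that the intersection in \<open>Ann_in\<close> runs over a
  nonempty set, so the annihilator stays inside \<open>M\<close>.\<close>

lemma cyclic_ann_iff:
  assumes n: "n \<in> carrier M"
  shows "x \<in> cyclic_ann R M n \<longleftrightarrow>
    x \<in> carrier M \<and> (\<forall>f\<in>mod_hom R M (M\<lparr>carrier := cyclic_submodule R M n\<rparr>). f x = \<zero>\<^bsub>M\<^esub>)"
proof -
  have "(\<lambda>x. \<zero>\<^bsub>M\<^esub>) \<in> mod_hom R M (M\<lparr>carrier := cyclic_submodule R M n\<rparr>)"
    using submodule_zero[OF cyclic_submodule_submodule[OF n]] by (auto simp: mod_hom_def)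
  then show ?thesis by (auto simp: Ann_in_def)
qed

text \<open>A homomorphism into \<open>Rn\<close> precomposed with an endomorphism of
  \<open>M\<close> is again a homomorphism into \<open>Rn\<close>, so it still kills the
  annihilator.\<close>

lemma cyclic_ann_fully_invariant:
  assumes n: "n \<in> carrier M"
  shows "fully_invariant R M (cyclic_ann R M n)"
proof -
  let ?K = "M\<lparr>carrier := cyclic_submodule R M n\<rparr>"
  interpret K: left_module R ?K
    by (rule submodule_left_module[OF cyclic_submodule_submodule[OF n]])
  note mem = cyclic_ann_iff[OF n]
  show ?thesis
    unfolding fully_invariant_def
  proof (intro conjI ballI image_subsetI)
    show "submodule (cyclic_ann R M n) R M"
    proof (rule left_submoduleI)
      show "\<zero>\<^bsub>M\<^esub> \<in> cyclic_ann R M n"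
        using mod_hom_zero[OF _ left_module_axioms K.left_module_axioms] by (simp add: mem)
      show "x \<oplus>\<^bsub>M\<^esub> y \<in> cyclic_ann R M n" if "x \<in> cyclic_ann R M n" "y \<in> cyclic_ann R M n" for x y
      proof -
        have "f (x \<oplus>\<^bsub>M\<^esub> y) = \<zero>\<^bsub>M\<^esub>" if f: "f \<in> mod_hom R M ?K" for f
        proof -
          have "f x = \<zero>\<^bsub>M\<^esub>" "f y = \<zero>\<^bsub>M\<^esub>" "x \<in> carrier M" "y \<in> carrier M"
            using \<open>x \<in> _\<close> \<open>y \<in> _\<close> f unfolding mem by blast+
          then show ?thesis using mod_homD(2)[OF f, of x y] by simp
        qed
        moreover have "x \<in> carrier M" "y \<in> carrier M" using that unfolding mem by blast+
        ultimately show ?thesis unfolding mem by simp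
      qed
      show "a \<odot>\<^bsub>M\<^esub> x \<in> cyclic_ann R M n" if "a \<in> carrier R" "x \<in> cyclic_ann R M n" for a x
      proof -
        have "f (a \<odot>\<^bsub>M\<^esub> x) = \<zero>\<^bsub>M\<^esub>" if f: "f \<in> mod_hom R M ?K" for f
        proof -
          have "f x = \<zero>\<^bsub>M\<^esub>" "x \<in> carrier M" using \<open>x \<in> _\<close> f unfolding mem by blast+
          then show ?thesis using mod_homD(3)[OF f \<open>a \<in> _\<close>, of x] \<open>a \<in> _\<close> by simp
        qed
        moreover have "x \<in> carrier M" using that unfolding mem by blast
        ultimately show ?thesis unfolding mem using that(1) by simp
      qed
    qed (auto simp: mem)
    show "f x \<in> cyclic_ann R M n" if "f \<in> mod_hom R M M" "x \<in> cyclic_ann R M n" for f x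
    proof -
      have "g (f x) = \<zero>\<^bsub>M\<^esub>" if "g \<in> mod_hom R M ?K" for g
      proof -
        have "\<forall>h\<in>mod_hom R M ?K. h x = \<zero>\<^bsub>M\<^esub>" using \<open>x \<in> _\<close> unfolding mem by blast
        from bspec[OF this mod_hom_comp[OF \<open>f \<in> _\<close> that]] show ?thesis .
      qed
      moreover have "f x \<in> carrier M" using mod_homD(1)[OF that(1)] that(2) unfolding mem by blast
      ultimately show ?thesis unfolding mem by blast
    qed
  qed
qed

text \<open>A homomorphism into \<open>R(x + y)\<close> lifts along \<open>R(x, y) \<rightarrow> R(x + y)\<close>, so it is a sum
  of homomorphisms into \<open>Rx\<close> and \<open>Ry\<close>.\<close>

lemma cyclic_ann_add:
  fixes x y :: 'm
  assumes proj: "projective_in_sigma TYPE(('r \<times> 'm) list) R M"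
    and x: "x \<in> carrier M" and y: "y \<in> carrier M"
  shows "cyclic_ann R M x \<inter> cyclic_ann R M y \<subseteq> cyclic_ann R M (x \<oplus>\<^bsub>M\<^esub> y)"
proof -
  note M = left_module_axioms
  let ?D = "direct_sum (UNIV :: bool set) M"
  interpret D: left_module R ?D by (rule direct_sum_left_module[OF M])
  \<comment> \<open>The direct sum over \<open>bool\<close> plays the role of the square of
    \<open>M\<close>, and \<open>z\<close> is the pair of \<open>x\<close> and
    \<open>y\<close>.\<close>
  define z where "z b = (if b then x else y)" for b :: bool
  have z: "z \<in> carrier ?D" using x y by (simp add: direct_sum_def z_def)
  have xy: "x \<oplus>\<^bsub>M\<^esub> y \<in> carrier M" using x y by simp
  let ?X = "?D\<lparr>carrier := cyclic_submodule R ?D z\<rparr>"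
  let ?Y = "\<lambda>n. M\<lparr>carrier := cyclic_submodule R M n\<rparr>"
  note subX = D.cyclic_submodule_submodule[OF z] and subY = cyclic_submodule_submodule[OF xy]
  have X: "left_module R ?X" by (rule D.submodule_left_module[OF subX])
  have Y: "left_module R (?Y (x \<oplus>\<^bsub>M\<^esub> y))" by (rule submodule_left_module[OF subY])
  have eX: "(\<lambda>v. v) \<in> mod_hom R ?X ?D"
    using submodule_subset[OF subX] by (intro mod_homI) auto
  \<comment> \<open>The diagonal embeds \<open>R(x + y)\<close> into the same direct sum that
    contains \<open>Rz\<close>, as \<open>projective_lift\<close> requires.\<close>
  have eY: "(\<lambda>m b. m) \<in> mod_hom R (?Y (x \<oplus>\<^bsub>M\<^esub> y)) ?D"
    using submodule_subset[OF subY] by (intro mod_homI) (auto simp: direct_sum_def)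
  have Xmem: "v \<in> cyclic_submodule R ?D z \<longleftrightarrow> (\<exists>r\<in>carrier R. v = (\<lambda>b. r \<odot>\<^bsub>M\<^esub> z b))" for v
    by (auto simp: cyclic_submodule_def direct_sum_def)
  have zc: "z b \<in> carrier M" for b using x y by (simp add: z_def)
  have vc: "v b \<in> carrier M" if "v \<in> cyclic_submodule R ?D z" for v b using that zc by (auto simp: Xmem)
  let ?p = "\<lambda>v. v True \<oplus>\<^bsub>M\<^esub> v False"
  have pz: "?p (\<lambda>b. r \<odot>\<^bsub>M\<^esub> z b) = r \<odot>\<^bsub>M\<^esub> (x \<oplus>\<^bsub>M\<^esub> y)" if "r \<in> carrier R" for r
    using that x y by (simp add: z_def smult_r_distr)
  have onto: "?p ` carrier ?X = carrier (?Y (x \<oplus>\<^bsub>M\<^esub> y))"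
  proof
    show "?p ` carrier ?X \<subseteq> carrier (?Y (x \<oplus>\<^bsub>M\<^esub> y))"
    proof (rule image_subsetI)
      fix v assume "v \<in> carrier ?X"
      then obtain r where "r \<in> carrier R" "v = (\<lambda>b. r \<odot>\<^bsub>M\<^esub> z b)" using Xmem by auto
      then show "?p v \<in> carrier (?Y (x \<oplus>\<^bsub>M\<^esub> y))"
        using pz by (auto simp: cyclic_submodule_def)
    qed
    show "carrier (?Y (x \<oplus>\<^bsub>M\<^esub> y)) \<subseteq> ?p ` carrier ?X"
    proof
      fix u assume "u \<in> carrier (?Y (x \<oplus>\<^bsub>M\<^esub> y))"
      then obtain r where r: "r \<in> carrier R" "u = r \<odot>\<^bsub>M\<^esub> (x \<oplus>\<^bsub>M\<^esub> y)"
        by (auto simp: cyclic_submodule_def)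
      then have "u = ?p (\<lambda>b. r \<odot>\<^bsub>M\<^esub> z b)" using pz by simp
      moreover have "(\<lambda>b. r \<odot>\<^bsub>M\<^esub> z b) \<in> carrier ?X" using r(1) Xmem by auto
      ultimately show "u \<in> ?p ` carrier ?X" by (rule image_eqI)
    qed
  qed
  have p: "?p \<in> mod_hom R ?X (?Y (x \<oplus>\<^bsub>M\<^esub> y))"
  proof (rule mod_homI)
    show "?p v \<in> carrier (?Y (x \<oplus>\<^bsub>M\<^esub> y))" if "v \<in> carrier ?X" for v
      using onto that by blast
  next
    fix u v assume "u \<in> carrier ?X" "v \<in> carrier ?X"
    then have "u b \<in> carrier M" "v b \<in> carrier M" for b using vc by simp_all
    then show "?p (u \<oplus>\<^bsub>?X\<^esub> v) = ?p u \<oplus>\<^bsub>?Y (x \<oplus>\<^bsub>M\<^esub> y)\<^esub> ?p v"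
      by (simp add: direct_sum_def M.a_ac)
  next
    fix r v assume "r \<in> carrier R" "v \<in> carrier ?X"
    moreover from this have "v b \<in> carrier M" for b using vc by simp
    ultimately show "?p (r \<odot>\<^bsub>?X\<^esub> v) = r \<odot>\<^bsub>?Y (x \<oplus>\<^bsub>M\<^esub> y)\<^esub> ?p v"
      by (simp add: direct_sum_def smult_r_distr)
  qed
  \<comment> \<open>The coordinates of \<open>rz\<close> are \<open>rx\<close> and
    \<open>ry\<close>. Composing the lift \<open>g\<close> with them gives homomorphisms into
    \<open>Rx\<close> and \<open>Ry\<close>, to which the two annihilators apply.\<close>
  have comp: "(\<lambda>v. v b) \<in> mod_hom R ?X (?Y (z b))" for b
  proof (rule mod_homI)
    fix v assume "v \<in> carrier ?X"
    then obtain r where "r \<in> carrier R" "v = (\<lambda>b. r \<odot>\<^bsub>M\<^esub> z b)" using Xmem by auto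
    then show "v b \<in> carrier (?Y (z b))" by (auto simp: cyclic_submodule_def)
  qed (simp_all add: direct_sum_def)
  have "f m = \<zero>\<^bsub>M\<^esub>"
    if m: "m \<in> cyclic_ann R M x" "m \<in> cyclic_ann R M y" and f: "f \<in> mod_hom R M (?Y (x \<oplus>\<^bsub>M\<^esub> y))"
    for f m
  proof -
    have mM: "m \<in> carrier M"
      using m(1) cyclic_ann_iff[OF x] by blast
    obtain g where g: "g \<in> mod_hom R M ?X" "\<And>m. m \<in> carrier M \<Longrightarrow> ?p (g m) = f m"
      using projective_lift[OF M proj X eX _ Y eY _ p onto f] by (auto simp: inj_on_def fun_eq_iff)
    have "g m True = \<zero>\<^bsub>M\<^esub>"
      using m(1) mod_hom_comp[OF g(1) comp[of True]] cyclic_ann_iff[OF x] by (simp add: z_def)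
    moreover have "g m False = \<zero>\<^bsub>M\<^esub>"
      using m(2) mod_hom_comp[OF g(1) comp[of False]] cyclic_ann_iff[OF y] by (simp add: z_def)
    ultimately show ?thesis using g(2)[OF mM] by simp
  qed
  then show ?thesis using cyclic_ann_iff[OF x] cyclic_ann_iff[OF xy] by blast
qed

lemma cyclic_ann_zero: "cyclic_ann R M \<zero>\<^bsub>M\<^esub> = carrier M"
proof -
  have "f x = \<zero>\<^bsub>M\<^esub>" if "f \<in> mod_hom R M (M\<lparr>carrier := cyclic_submodule R M \<zero>\<^bsub>M\<^esub>\<rparr>)" "x \<in> carrier M"
    for f x
    using mod_homD(1)[OF that] by (auto simp: cyclic_submodule_def)
  then show ?thesis using cyclic_ann_iff[OF M.zero_closed] by blast
qed

end

section \<open>Sums of submodules\<close>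

text \<open>The sum of the submodules in \<open>S\<close>, built one summand at a time so that its
  induction rule adds a single element of a single member. The empty family gives the zero
  submodule.\<close>

inductive_set sum_span :: "('r, 'm, 'b) module_scheme \<Rightarrow> 'm set set \<Rightarrow> 'm set"
  for M :: "('r, 'm, 'b) module_scheme" and S :: "'m set set" where
  zero: "\<zero>\<^bsub>M\<^esub> \<in> sum_span M S"
| add: "\<lbrakk>N \<in> S; x \<in> N; y \<in> sum_span M S\<rbrakk> \<Longrightarrow> x \<oplus>\<^bsub>M\<^esub> y \<in> sum_span M S"

lemma sum_span_least:
  assumes K: "submodule K R M" "\<And>N. N \<in> S \<Longrightarrow> N \<subseteq> K"
  shows "sum_span M S \<subseteq> K"
proof
  fix x assume "x \<in> sum_span M S"
  then show "x \<in> K"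
    by induction (use K submodule_zero submodule_add[OF K(1)] in blast)+
qed

text \<open>Of two members of a chain one contains the other, so a sum of elements of both stays in
  the larger one. This is what makes unions of chains available for Zorn's lemma.\<close>

lemma sum_span_chain:
  assumes sub: "\<And>N. N \<in> S \<Longrightarrow> submodule N R M" and "S \<noteq> {}"
    and chain: "\<And>A B. \<lbrakk>A \<in> S; B \<in> S\<rbrakk> \<Longrightarrow> A \<subseteq> B \<or> B \<subseteq> A"
  shows "sum_span M S \<subseteq> \<Union>S"
proof
  fix x assume "x \<in> sum_span M S"
  then show "x \<in> \<Union>S"
  proof induction
    case zero
    then show ?case using sub \<open>S \<noteq> {}\<close> submodule_zero by blast
  next
    case (add N x y)
    then obtain K where K: "K \<in> S" "y \<in> K" by blast
    show ?case
    proof (cases "N \<subseteq> K")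
      case True
      then have "x \<oplus>\<^bsub>M\<^esub> y \<in> K" using submodule_add[OF sub[OF K(1)]] add.hyps(2) K(2) by blast
      then show ?thesis using K(1) by blast
    next
      case False
      then have "x \<oplus>\<^bsub>M\<^esub> y \<in> N"
        using submodule_add[OF sub[OF add.hyps(1)]] add.hyps(1,2) K chain by blast
      then show ?thesis using add.hyps(1) by blast
    qed
  qed
qed

context left_module
begin

lemma sum_span_upper:
  assumes "submodule N R M" "N \<in> S"
  shows "N \<subseteq> sum_span M S"
proof
  fix x assume "x \<in> N"
  then have "x \<oplus>\<^bsub>M\<^esub> \<zero>\<^bsub>M\<^esub> \<in> sum_span M S" using assms(2) by (blast intro: sum_span.intros)
  then show "x \<in> sum_span M S" using \<open>x \<in> N\<close> submodule_subset[OF assms(1)] by (simp add: subset_iff)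
qed

lemma sum_span_submodule:
  assumes sub: "\<And>N. N \<in> S \<Longrightarrow> submodule N R M"
  shows "submodule (sum_span M S) R M"
proof (rule left_submoduleI)
  have car: "submodule (carrier M) R M" by (rule fully_invariant_submodule[OF fully_invariant_carrier])
  show subset: "sum_span M S \<subseteq> carrier M"
    using sub submodule_subset by (intro sum_span_least[OF car]) blast
  show "\<zero>\<^bsub>M\<^esub> \<in> sum_span M S" by (rule sum_span.zero)
  show "x \<oplus>\<^bsub>M\<^esub> y \<in> sum_span M S" if "x \<in> sum_span M S" "y \<in> sum_span M S" for x y
    using that
  proof (induction arbitrary: y rule: sum_span.induct)
    case zero
    then show ?case using subset by (simp add: subset_iff)
  next
    case (add N x z)
    have "x \<in> carrier M" "z \<in> carrier M" "y \<in> carrier M"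
      using add.hyps add.prems subset submodule_subset[OF sub[OF add.hyps(1)]] by blast+
    then show ?case
      using sum_span.add[OF add.hyps(1,2) add.IH[OF add.prems]] by (simp add: M.a_assoc)
  qed
  show "a \<odot>\<^bsub>M\<^esub> x \<in> sum_span M S" if a: "a \<in> carrier R" and x: "x \<in> sum_span M S" for a x
    using x
  proof induction
    case zero
    then show ?case using a by (simp add: sum_span.zero)
  next
    case (add N x z)
    have "x \<in> carrier M" "z \<in> carrier M"
      using add.hyps subset submodule_subset[OF sub[OF add.hyps(1)]] by blast+
    moreover have "a \<odot>\<^bsub>M\<^esub> x \<in> N" using submodule.smult_closed[OF sub[OF add.hyps(1)] a add.hyps(2)] .
    ultimately show ?case
      using a sum_span.add[OF add.hyps(1) _ add.IH] by (simp add: smult_r_distr)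
  qed
qed

lemma sum_span_fully_invariant:
  assumes fi: "\<And>N. N \<in> S \<Longrightarrow> fully_invariant R M N"
  shows "fully_invariant R M (sum_span M S)"
  unfolding fully_invariant_def
proof (intro conjI ballI image_subsetI)
  have sub: "submodule N R M" if "N \<in> S" for N using fully_invariant_submodule[OF fi[OF that]] .
  show span: "submodule (sum_span M S) R M" by (rule sum_span_submodule[OF sub])
  fix f x assume f: "f \<in> mod_hom R M M" and "x \<in> sum_span M S"
  from this(2) show "f x \<in> sum_span M S"
  proof induction
    case zero
    show ?case
      using mod_hom_zero[OF f left_module_axioms left_module_axioms] by (simp add: sum_span.zero)
  next
    case (add N x z)
    have "x \<in> carrier M" "z \<in> carrier M"
      using add.hyps submodule_subset[OF sub[OF add.hyps(1)]] submodule_subset[OF span] by blast+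
    then show ?case
      using sum_span.add[OF add.hyps(1) fully_invariantD[OF fi[OF add.hyps(1)] f add.hyps(2)] add.IH]
      by (simp add: mod_homD(2)[OF f])
  qed
qed

end

section \<open>Closure properties of \<open>\<Psi>(M)\<close>\<close>

context left_module
begin

lemma PsiD:
  assumes "N \<in> Psi R M"
  shows "fully_invariant R M N" "submodule N R M" "N \<subseteq> carrier M"
    and "n \<in> N \<Longrightarrow> N <+>\<^bsub>M\<^esub> cyclic_ann R M n = carrier M"
proof -
  show fi: "fully_invariant R M N" using assms by (simp add: Psi_def)
  show sub: "submodule N R M" by (rule fully_invariant_submodule[OF fi])
  show "N \<subseteq> carrier M" by (rule submodule_subset[OF sub])
  show "N <+>\<^bsub>M\<^esub> cyclic_ann R M n = carrier M" if "n \<in> N" using assms that by (simp add: Psi_def)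
qed

lemma PsiI:
  assumes N: "fully_invariant R M N"
    and "\<And>n. n \<in> N \<Longrightarrow> carrier M \<subseteq> N <+>\<^bsub>M\<^esub> cyclic_ann R M n"
  shows "N \<in> Psi R M"
proof -
  have "N <+>\<^bsub>M\<^esub> cyclic_ann R M n \<subseteq> carrier M" if "n \<in> N" for n
  proof -
    have "N \<subseteq> carrier M" using submodule_subset[OF fully_invariant_submodule[OF N]] .
    moreover from this have "cyclic_ann R M n \<subseteq> carrier M" using that cyclic_ann_iff by blast
    ultimately show ?thesis by (auto elim!: set_add_memE)
  qed
  with assms show ?thesis unfolding Psi_def by blast
qed

end

section \<open>Decompositions of submodules of a self-progenerator\<close>

locale self_progenerator_module = left_module R M
  for R :: "('r, 'a) ring_scheme" (structure) and M :: "('r, 'm, 'b) module_scheme" (structure) +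
  assumes self_progenerator: "self_progenerator R M"
begin

text \<open>The condition that \<open>M\<close> generates its submodules enters through this
  lemma.\<close>

lemma submodule_subset_if_images:
  assumes K: "submodule K R M"
    and "\<zero>\<^bsub>M\<^esub> \<in> T" "\<And>x y. \<lbrakk>x \<in> T; y \<in> T\<rbrakk> \<Longrightarrow> x \<oplus>\<^bsub>M\<^esub> y \<in> T"
    and "\<And>f m. \<lbrakk>f \<in> mod_hom R M (M\<lparr>carrier := K\<rparr>); m \<in> carrier M\<rbrakk> \<Longrightarrow> f m \<in> T"
  shows "K \<subseteq> T"
proof -
  have "M_generated TYPE(('r \<times> 'm) list) R M (M\<lparr>carrier := K\<rparr>)"
    using self_progenerator K by (simp add: self_progenerator_def)
  from generated_subset[OF left_module_axioms submodule_left_module[OF K] this, of T] show ?thesis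
    using assms by simp
qed

text \<open>Submodule lattices are in general only modular, so this distribution needs an argument.
  For \<open>f\<close> from \<open>M\<close> to \<open>K\<close> and \<open>m = a + i\<close>, the
  elements \<open>f a\<close> and \<open>f i\<close> lie in \<open>K\<close>, and in
  \<open>A\<close> and \<open>I\<close> by full invariance. Such images generate
  \<open>K\<close>.\<close>

lemma submodule_subset_split:
  assumes A: "fully_invariant R M A" and I: "fully_invariant R M I"
    and AI: "A <+>\<^bsub>M\<^esub> I = carrier M" and K: "submodule K R M"
  shows "K \<subseteq> (A \<inter> K) <+>\<^bsub>M\<^esub> (I \<inter> K)"
proof (rule submodule_subset_if_images[OF K])
  have AK: "submodule (A \<inter> K) R M" and IK: "submodule (I \<inter> K) R M"
    using A I K by (simp_all add: submodule_Int fully_invariant_submodule)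
  have car: "A \<inter> K \<subseteq> carrier M" "I \<inter> K \<subseteq> carrier M"
    using submodule_subset AK IK by blast+
  show "\<zero>\<^bsub>M\<^esub> \<in> (A \<inter> K) <+>\<^bsub>M\<^esub> (I \<inter> K)"
    by (rule set_add_memI[OF submodule_zero[OF AK] submodule_zero[OF IK]]) simp
  show "x \<oplus>\<^bsub>M\<^esub> y \<in> (A \<inter> K) <+>\<^bsub>M\<^esub> (I \<inter> K)"
    if x: "x \<in> (A \<inter> K) <+>\<^bsub>M\<^esub> (I \<inter> K)" and y: "y \<in> (A \<inter> K) <+>\<^bsub>M\<^esub> (I \<inter> K)" for x y
  proof -
    obtain a i where ai: "a \<in> A \<inter> K" "i \<in> I \<inter> K" "x = a \<oplus>\<^bsub>M\<^esub> i"
      using x by (rule set_add_memE)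
    obtain b j where bj: "b \<in> A \<inter> K" "j \<in> I \<inter> K" "y = b \<oplus>\<^bsub>M\<^esub> j"
      using y by (rule set_add_memE)
    have "a \<in> carrier M" "i \<in> carrier M" "b \<in> carrier M" "j \<in> carrier M"
      using car ai(1,2) bj(1,2) by blast+
    then have "x \<oplus>\<^bsub>M\<^esub> y = (a \<oplus>\<^bsub>M\<^esub> b) \<oplus>\<^bsub>M\<^esub> (i \<oplus>\<^bsub>M\<^esub> j)"
      unfolding ai(3) bj(3) by (simp add: M.a_ac)
    then show ?thesis
      by (rule set_add_memI[OF submodule_add[OF AK ai(1) bj(1)] submodule_add[OF IK ai(2) bj(2)]])
  qed
  show "f m \<in> (A \<inter> K) <+>\<^bsub>M\<^esub> (I \<inter> K)"
    if f: "f \<in> mod_hom R M (M\<lparr>carrier := K\<rparr>)" and m: "m \<in> carrier M" for f m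
  proof -
    \<comment> \<open>Read as an endomorphism of \<open>M\<close>, \<open>f\<close> preserves
      \<open>A\<close> and \<open>I\<close>.\<close>
    have fM: "f \<in> mod_hom R M M" and fK: "f x \<in> K" if "x \<in> carrier M" for x
      using f that submodule_subset[OF K] by (auto simp: mod_hom_submodule_carrier)
    obtain a i where ai: "a \<in> A" "i \<in> I" "m = a \<oplus>\<^bsub>M\<^esub> i"
      using m unfolding AI[symmetric] by (rule set_add_memE)
    have c: "a \<in> carrier M" "i \<in> carrier M"
      using ai submodule_subset fully_invariant_submodule A I by blast+
    show ?thesis
    proof (rule set_add_memI)
      show "f a \<in> A \<inter> K" using fully_invariantD[OF A fM ai(1)] fK c by blast
      show "f i \<in> I \<inter> K" using fully_invariantD[OF I fM ai(2)] fK c by blast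
      show "f m = f a \<oplus>\<^bsub>M\<^esub> f i" using mod_homD(2)[OF fM] c ai(3) by simp
    qed
  qed
qed

text \<open>For \<open>n\<close> in both sets and \<open>I = Ann(Rn)\<close>, the equation
  \<open>M = A + I\<close> splits \<open>B\<close> into
  \<open>(A \<inter> B) + (I \<inter> B)\<close>. Substituting this into \<open>M = B + I\<close>
  leaves \<open>M = (A \<inter> B) + I\<close>.\<close>

lemma Psi_Int:
  assumes A: "A \<in> Psi R M" and B: "B \<in> Psi R M"
  shows "A \<inter> B \<in> Psi R M"
proof (rule PsiI)
  show "fully_invariant R M (A \<inter> B)" by (rule fully_invariant_Int[OF PsiD(1)[OF A] PsiD(1)[OF B]])
  fix n assume n: "n \<in> A \<inter> B"
  let ?I = "cyclic_ann R M n"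
  have "n \<in> carrier M" using n PsiD(3)[OF A] by blast
  note I = cyclic_ann_fully_invariant[OF this]
  note Is = fully_invariant_submodule[OF I]
  have "A <+>\<^bsub>M\<^esub> ?I = carrier M" using PsiD(4)[OF A] n by blast
  note split = submodule_subset_split[OF PsiD(1)[OF A] I this PsiD(2)[OF B]]
  show "carrier M \<subseteq> (A \<inter> B) <+>\<^bsub>M\<^esub> ?I"
  proof
    fix m assume "m \<in> carrier M"
    then have "m \<in> B <+>\<^bsub>M\<^esub> ?I" using PsiD(4)[OF B, of n] n by simp
    then obtain b y where bz: "b \<in> B" "y \<in> ?I" "m = b \<oplus>\<^bsub>M\<^esub> y" by (rule set_add_memE)
    from bz(1) split have "b \<in> (A \<inter> B) <+>\<^bsub>M\<^esub> (?I \<inter> B)" by blast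
    then obtain c z where cz: "c \<in> A \<inter> B" "z \<in> ?I \<inter> B" "b = c \<oplus>\<^bsub>M\<^esub> z" by (rule set_add_memE)
    have "c \<in> carrier M" "z \<in> carrier M" "y \<in> carrier M"
      using cz(1,2) bz(2) PsiD(3)[OF B] submodule_subset[OF Is] by blast+
    then have "m = c \<oplus>\<^bsub>M\<^esub> (z \<oplus>\<^bsub>M\<^esub> y)" unfolding bz(3) cz(3) by (simp add: M.a_assoc)
    moreover have "z \<oplus>\<^bsub>M\<^esub> y \<in> ?I" using submodule_add[OF Is] cz(2) bz(2) by blast
    ultimately show "m \<in> (A \<inter> B) <+>\<^bsub>M\<^esub> ?I" by (intro set_add_memI[OF cz(1)])
  qed
qed

text \<open>A version of the defining condition of \<open>\<Psi>(M)\<close> relative to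
  \<open>A\<close>: the case \<open>A = M\<close> gives closure under sums, the case
  \<open>A \<in> \<Psi>(M)\<close> gives distributivity. When \<open>x \<in> N\<close> is added to
  \<open>y\<close>, the remainder in \<open>A \<inter> Ann(Ry)\<close> is split along
  \<open>M = N + Ann(Rx)\<close>. One part falls into \<open>A \<inter> N\<close>, the other into
  \<open>Ann(Rx) \<inter> Ann(Ry)\<close>, which is contained in
  \<open>Ann(R(x + y))\<close>.\<close>

lemma subset_sum_span_add_ann:
  assumes S: "S \<subseteq> Psi R M" and A: "submodule A R M" and "n \<in> sum_span M S"
  shows "A \<subseteq> sum_span M ((\<inter>) A ` S) <+>\<^bsub>M\<^esub> (A \<inter> cyclic_ann R M n)"
  using assms(3)
proof induction
  \<comment> \<open>The annihilator of the zero module is \<open>M\<close>, so \<open>a\<close>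
    itself is the remainder.\<close>
  case zero
  show ?case
  proof
    fix a assume "a \<in> A"
    moreover from this have "a \<in> carrier M" using submodule_subset[OF A] by blast
    ultimately show "a \<in> sum_span M ((\<inter>) A ` S) <+>\<^bsub>M\<^esub> (A \<inter> cyclic_ann R M \<zero>\<^bsub>M\<^esub>)"
      by (intro set_add_memI[OF sum_span.zero, of a]) (simp_all add: cyclic_ann_zero)
  qed
next
  case (add N x y)
  let ?E = "sum_span M ((\<inter>) A ` S)" and ?I = "cyclic_ann R M x" and ?J = "cyclic_ann R M y"
  have N: "N \<in> Psi R M" using S add.hyps(1) by blast
  have sub: "submodule N R M" if "N \<in> (\<inter>) A ` S" for N
    using that S PsiD(2) submodule_Int[OF A] by blast
  have E: "submodule ?E R M" by (rule sum_span_submodule[OF sub])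
  have "submodule (sum_span M S) R M" by (rule sum_span_submodule) (use S PsiD(2) in blast)
  then have y: "y \<in> carrier M" using add.hyps(3) submodule_subset by blast
  have x: "x \<in> carrier M" using add.hyps(2) PsiD(3)[OF N] by blast
  have AJ: "submodule (A \<inter> ?J) R M"
    by (rule submodule_Int[OF A fully_invariant_submodule[OF cyclic_ann_fully_invariant[OF y]]])
  note split = submodule_subset_split[OF PsiD(1)[OF N] cyclic_ann_fully_invariant[OF x]
      PsiD(4)[OF N add.hyps(2)] AJ]
  have ann: "?I \<inter> ?J \<subseteq> cyclic_ann R M (x \<oplus>\<^bsub>M\<^esub> y)"
    using cyclic_ann_add[OF _ x y] self_progenerator by (simp add: self_progenerator_def)
  show ?case
  proof
    fix a assume "a \<in> A"
    then have "a \<in> ?E <+>\<^bsub>M\<^esub> (A \<inter> ?J)" using add.IH by blast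
    then obtain e k where ek: "e \<in> ?E" "k \<in> A \<inter> ?J" "a = e \<oplus>\<^bsub>M\<^esub> k" by (rule set_add_memE)
    from ek(2) split have "k \<in> (N \<inter> (A \<inter> ?J)) <+>\<^bsub>M\<^esub> (?I \<inter> (A \<inter> ?J))" by blast
    then obtain u w where uw: "u \<in> N \<inter> (A \<inter> ?J)" "w \<in> ?I \<inter> (A \<inter> ?J)" "k = u \<oplus>\<^bsub>M\<^esub> w"
      by (rule set_add_memE)
    have AN: "A \<inter> N \<in> (\<inter>) A ` S" using add.hyps(1) by blast
    have u: "u \<in> ?E" using uw(1) sum_span_upper[OF sub[OF AN] AN] by blast
    have "e \<in> carrier M" "u \<in> carrier M" "w \<in> carrier M"
      using ek(1) u uw(2) submodule_subset[OF E] submodule_subset[OF A] by blast+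
    then have "a = (e \<oplus>\<^bsub>M\<^esub> u) \<oplus>\<^bsub>M\<^esub> w" unfolding ek(3) uw(3) by (simp add: M.a_assoc)
    then show "a \<in> ?E <+>\<^bsub>M\<^esub> (A \<inter> cyclic_ann R M (x \<oplus>\<^bsub>M\<^esub> y))"
      using submodule_add[OF E ek(1) u] uw(2) ann by (intro set_add_memI[of "e \<oplus>\<^bsub>M\<^esub> u" _ w]) blast+
  qed
qed

lemma Psi_sum_span:
  assumes S: "S \<subseteq> Psi R M"
  shows "sum_span M S \<in> Psi R M"
proof (rule PsiI)
  show "fully_invariant R M (sum_span M S)"
    by (rule sum_span_fully_invariant) (use S PsiD(1) in blast)
  \<comment> \<open>This prepares the case \<open>A = M\<close> of
    \<open>subset_sum_span_add_ann\<close>.\<close>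
  have "(\<inter>) (carrier M) ` S = (\<lambda>N. N) ` S" using S PsiD(3) by (intro image_cong) blast+
  then have eq: "(\<inter>) (carrier M) ` S = S" by simp
  fix n assume n: "n \<in> sum_span M S"
  show "carrier M \<subseteq> sum_span M S <+>\<^bsub>M\<^esub> cyclic_ann R M n"
    using subset_sum_span_add_ann[OF S fully_invariant_submodule[OF fully_invariant_carrier] n]
    unfolding eq by (blast elim!: set_add_memE intro: set_add_memI)
qed

text \<open>It suffices to bring \<open>f m\<close> into \<open>?E\<close> for every
  \<open>f\<close> from \<open>M\<close> to \<open>Rn\<close>, since such images generate
  \<open>Rn\<close>. As \<open>M = A + Ann(Rn)\<close> and \<open>A\<close> lies in
  \<open>?E + (A \<inter> Ann(Rn))\<close>, each \<open>m\<close> is some \<open>e\<close> in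
  \<open>?E\<close> plus elements killed by \<open>f\<close>. So \<open>f m = f e\<close>, which
  lies in \<open>?E\<close> by full invariance.\<close>

lemma Psi_distrib:
  assumes A: "A \<in> Psi R M" and S: "S \<subseteq> Psi R M"
  shows "A \<inter> sum_span M S \<subseteq> sum_span M ((\<inter>) A ` S)"
proof
  let ?E = "sum_span M ((\<inter>) A ` S)"
  fix n assume n: "n \<in> A \<inter> sum_span M S"
  let ?I = "cyclic_ann R M n" and ?K = "cyclic_submodule R M n"
  have nM: "n \<in> carrier M" using n PsiD(3)[OF A] by blast
  have E: "fully_invariant R M ?E"
    by (rule sum_span_fully_invariant) (use S A PsiD(1) fully_invariant_Int in blast)
  note Es = fully_invariant_submodule[OF E]
  note K = cyclic_submodule_submodule[OF nM]
  have "?K \<subseteq> ?E"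
  proof (rule submodule_subset_if_images[OF K submodule_zero[OF Es] submodule_add[OF Es]])
    fix f m assume f: "f \<in> mod_hom R M (M\<lparr>carrier := ?K\<rparr>)" and m: "m \<in> carrier M"
    have fM: "f \<in> mod_hom R M M"
      using f submodule_subset[OF K] by (auto simp: mod_hom_submodule_carrier)
    have kill: "f z = \<zero>\<^bsub>M\<^esub>" if "z \<in> ?I" for z using that f cyclic_ann_iff[OF nM] by blast
    have "m \<in> A <+>\<^bsub>M\<^esub> ?I" using m n PsiD(4)[OF A, of n] by simp
    then obtain a y where ay: "a \<in> A" "y \<in> ?I" "m = a \<oplus>\<^bsub>M\<^esub> y" by (rule set_add_memE)
    have "a \<in> ?E <+>\<^bsub>M\<^esub> (A \<inter> ?I)"
      using subset_sum_span_add_ann[OF S PsiD(2)[OF A], of n] n ay(1) by blast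
    then obtain e z where ez: "e \<in> ?E" "z \<in> A \<inter> ?I" "a = e \<oplus>\<^bsub>M\<^esub> z" by (rule set_add_memE)
    have c: "a \<in> carrier M" "y \<in> carrier M" "e \<in> carrier M" "z \<in> carrier M"
      using ay(1,2) ez(1,2) PsiD(3)[OF A] submodule_subset[OF Es] cyclic_ann_iff[OF nM] by blast+
    have "f m = f e"
      using c kill[OF ay(2)] kill[of z] ez(2) mod_homD(1,2)[OF fM] unfolding ay(3) ez(3) by simp
    then show "f m \<in> ?E" using fully_invariantD[OF E fM ez(1)] by simp
  qed
  then show "n \<in> ?E" using cyclic_submodule_self[OF nM] by blast
qed

end

section \<open>Frames of sets\<close>

text \<open>The remaining argument concerns sets only: meets are intersections, and \<open>J\<close>
  gives the joins. By \<open>chain\<close> and \<open>upper\<close>, the join of a nonempty chain is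
  its union, so a point avoided by every member is avoided by the join.\<close>

lemma frame_spatial_inclusion_order:
  fixes S :: "'a set set" and J :: "'a set set \<Rightarrow> 'a set"
  assumes Int: "\<And>A B. \<lbrakk>A \<in> S; B \<in> S\<rbrakk> \<Longrightarrow> A \<inter> B \<in> S"
    and closed: "\<And>C. C \<subseteq> S \<Longrightarrow> J C \<in> S"
    and upper: "\<And>C A. \<lbrakk>C \<subseteq> S; A \<in> C\<rbrakk> \<Longrightarrow> A \<subseteq> J C"
    and least: "\<And>C B. \<lbrakk>C \<subseteq> S; B \<in> S; \<And>A. A \<in> C \<Longrightarrow> A \<subseteq> B\<rbrakk> \<Longrightarrow> J C \<subseteq> B"
    and distrib: "\<And>A C. \<lbrakk>A \<in> S; C \<subseteq> S\<rbrakk> \<Longrightarrow> A \<inter> J C \<subseteq> J ((\<inter>) A ` C)"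
    and chain: "\<And>C. \<lbrakk>C \<noteq> {}; subset.chain S C\<rbrakk> \<Longrightarrow> J C \<subseteq> \<Union>C"
  shows "frame (inclusion_order S) \<and> spatial (inclusion_order S)"
proof -
  let ?L = "inclusion_order S"
  have [simp]: "carrier ?L = S" "le ?L = (\<subseteq>)" "eq ?L = (=)" by (simp_all add: inclusion_order_def)
  interpret L: partial_order ?L by standard auto
  have lub: "least ?L (J C) (Upper ?L C)" if "C \<subseteq> S" for C
  proof -
    have "J C \<subseteq> B" if "B \<in> S" "\<forall>A. A \<in> C \<inter> S \<longrightarrow> A \<subseteq> B" for B
      using that \<open>C \<subseteq> S\<close> by (intro least) blast+
    then show ?thesis
      using closed[OF that] upper[OF that] by (simp add: least_def Upper_def)
  qed
  \<comment> \<open>Only binary intersections are assumed to stay in \<open>S\<close>, so an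
    arbitrary meet is taken as the join of all lower bounds.\<close>
  have glb: "greatest ?L (J {B \<in> S. \<forall>A\<in>C. B \<subseteq> A}) (Lower ?L C)" if "C \<subseteq> S" for C
  proof -
    have "J {B \<in> S. \<forall>A\<in>C. B \<subseteq> A} \<subseteq> A" if "A \<in> C" for A
      using that \<open>C \<subseteq> S\<close> by (intro least) auto
    moreover have "B \<subseteq> J {B \<in> S. \<forall>A\<in>C. B \<subseteq> A}" if "B \<in> S" "\<forall>A. A \<in> C \<inter> S \<longrightarrow> B \<subseteq> A" for B
      using that \<open>C \<subseteq> S\<close> by (intro upper) auto
    moreover have "J {B \<in> S. \<forall>A\<in>C. B \<subseteq> A} \<in> S" by (intro closed) blast
    ultimately show ?thesis by (simp add: greatest_def Lower_def)
  qed
  interpret L: complete_lattice ?L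
    by (rule L.complete_latticeI) (use lub glb in auto)
  have sup: "\<Squnion>\<^bsub>?L\<^esub>C = J C" if "C \<subseteq> S" for C
    using lub[OF that] L.least_unique[OF _ lub[OF that]] unfolding sup_def by (rule someI2)
  have meet: "A \<sqinter>\<^bsub>?L\<^esub> B = A \<inter> B" if "A \<in> S" "B \<in> S" for A B
  proof -
    have g: "greatest ?L (A \<inter> B) (Lower ?L {A, B})"
      using that Int by (auto simp: greatest_def Lower_def)
    show ?thesis
      using g L.greatest_unique[OF _ g] unfolding meet_def inf_def by (rule someI2)
  qed
  have "frame ?L"
  proof
    fix A C assume "A \<in> carrier ?L" "C \<subseteq> carrier ?L"
    then have A: "A \<in> S" and C: "C \<subseteq> S" by simp_all
    have AC: "(\<inter>) A ` C \<subseteq> S" using A C Int by blast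
    have "(\<lambda>x. A \<sqinter>\<^bsub>?L\<^esub> x) ` C = (\<inter>) A ` C" using A C meet by (intro image_cong) auto
    moreover have "A \<inter> J C = J ((\<inter>) A ` C)"
    proof
      show "J ((\<inter>) A ` C) \<subseteq> A \<inter> J C"
        using upper[OF C] by (intro least[OF AC Int[OF A closed[OF C]]]) blast
    qed (rule distrib[OF A C])
    ultimately show "A \<sqinter>\<^bsub>?L\<^esub> (\<Squnion>\<^bsub>?L\<^esub>C) = \<Squnion>\<^bsub>?L\<^esub>((\<lambda>x. A \<sqinter>\<^bsub>?L\<^esub> x) ` C)"
      using sup[OF C] sup[OF AC] meet[OF A closed[OF C]] by simp
  qed
  moreover have "a \<subseteq> b"
    if a: "a \<in> S" and b: "b \<in> S" and open_eq: "pt_open ?L a = pt_open ?L b" for a b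
  proof (rule subsetI, rule ccontr)
    fix n assume n: "n \<in> a" "n \<notin> b"
    \<comment> \<open>A maximal member of \<open>P\<close> will be a point that contains
      \<open>b\<close> but not \<open>a\<close>, contradicting \<open>open_eq\<close>.\<close>
    define P where "P = {p \<in> S. b \<subseteq> p \<and> n \<notin> p}"
    have "\<exists>p\<in>P. \<forall>q\<in>P. p \<subseteq> q \<longrightarrow> q = p"
    proof (rule subset_Zorn_nonempty)
      show "P \<noteq> {}" using b n by (auto simp: P_def)
      fix C assume C: "C \<noteq> {}" "subset.chain P C"
      then have CS: "C \<subseteq> S" "subset.chain S C" by (auto simp: subset_chain_def P_def)
      have "\<Union>C = J C" using chain[OF C(1) CS(2)] upper[OF CS(1)] by blast
      then have "\<Union>C \<in> S" using closed[OF CS(1)] by simp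
      with C show "\<Union>C \<in> P" by (fastforce simp: subset_chain_def P_def)
    qed
    then obtain p where "p \<in> P" and maxP: "\<forall>q\<in>P. p \<subseteq> q \<longrightarrow> q = p" ..
    then have p: "p \<in> S" "b \<subseteq> p" "n \<notin> p" by (simp_all add: P_def)
    have max: "q = p" if "q \<in> S" "p \<subseteq> q" "n \<notin> q" for q
      using maxP that p(2) by (simp add: P_def)
    have join: "J {c, p} \<in> S" "c \<subseteq> J {c, p}" "p \<subseteq> J {c, p}" if "c \<in> S" for c
      using closed[of "{c, p}"] upper[of "{c, p}"] that p(1) by auto
    \<comment> \<open>The join is strictly larger than \<open>p\<close>, so by maximality it cannot
      avoid \<open>n\<close>.\<close>
    have mem: "n \<in> J {c, p}" if "c \<in> S" "\<not> c \<subseteq> p" for c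
      using max[OF join(1)[OF that(1)] join(3)[OF that(1)]] join(2)[OF that(1)] that(2) by blast
    have absorb: "A \<inter> J {c, p} \<subseteq> p" if A: "A \<in> S" and c: "c \<in> S" and "A \<inter> c \<subseteq> p" for A c
    proof -
      have "A \<inter> J {c, p} \<subseteq> J {A \<inter> c, A \<inter> p}" using distrib[of A "{c, p}"] A c p(1) by simp
      also have "\<dots> \<subseteq> p" using A c p(1) Int \<open>A \<inter> c \<subseteq> p\<close> by (intro least) auto
      finally show ?thesis .
    qed
    \<comment> \<open>If both inclusions fail, \<open>n\<close> lies in both joins with
      \<open>p\<close>. Applying \<open>absorb\<close> twice, first enlarging \<open>c\<close> and
      then \<open>d\<close>, puts the intersection of these joins inside \<open>p\<close>, which
      avoids \<open>n\<close>.\<close>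
    have prime: "c \<subseteq> p \<or> d \<subseteq> p" if "c \<in> S" "d \<in> S" "c \<inter> d \<subseteq> p" for c d
    proof (rule ccontr)
      assume "\<not> ?thesis"
      then have "n \<in> J {c, p} \<inter> J {d, p}" using mem that by blast
      moreover have "d \<inter> J {c, p} \<subseteq> p" using absorb[of d c] that by blast
      then have "J {c, p} \<inter> J {d, p} \<subseteq> p"
        using absorb[of "J {c, p}" d] join(1)[of c] that by blast
      ultimately show False using p(3) by blast
    qed
    \<comment> \<open>The top element contains \<open>a\<close>, hence \<open>n\<close>.\<close>
    have "p \<noteq> \<top>\<^bsub>?L\<^esub>" using L.top_higher[of a] a n(1) p(3) by auto
    then have "p \<in> pt ?L" using p(1) prime meet by (auto simp: pt_def)
    moreover have "\<not> a \<subseteq> p" using n(1) p(3) by blast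
    ultimately have "p \<in> pt_open ?L a" by (simp add: pt_open_def)
    then have "\<not> b \<subseteq> p" unfolding open_eq by (simp add: pt_open_def)
    with p(2) show False by simp
  qed
  then have "spatial ?L" unfolding spatial_def by (intro inj_onI subset_antisym) auto
  ultimately show ?thesis by blast
qed

theorem theorem5p6:
  fixes R :: "('r, 'a) ring_scheme" and M :: "('r, 'm, 'b) module_scheme"
  assumes "left_module R M"
    and "self_progenerator R M"
  shows "frame (inclusion_order (Psi R M)) \<and> spatial (inclusion_order (Psi R M))"
proof -
  interpret self_progenerator_module R M
    using assms by (intro self_progenerator_module.intro self_progenerator_module_axioms.intro)
  show ?thesis
  proof (rule frame_spatial_inclusion_order[where J = "sum_span M"])
    show "sum_span M C \<subseteq> \<Union>C" if "C \<noteq> {}" "subset.chain (Psi R M) C" for C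
      using that PsiD(2) by (intro sum_span_chain) (auto simp: subset_chain_def)
    show "A \<subseteq> sum_span M C" if "C \<subseteq> Psi R M" "A \<in> C" for C A
      using that PsiD(2) by (intro sum_span_upper) blast+
    show "sum_span M C \<subseteq> B" if "B \<in> Psi R M" "\<And>A. A \<in> C \<Longrightarrow> A \<subseteq> B" for C B
      by (rule sum_span_least[OF PsiD(2)[OF that(1)] that(2)])
  qed (fact Psi_Int Psi_sum_span Psi_distrib)+
qed

end
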